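(* Let $p$ be an odd prime and let $G=([n],E)$ be a simple undirected graph with vertex set $[n]=\{1,\dots,n\}$ and $m=|E|\geq 1$ edges. Let $P_G\in\mathfrak{B}_{p,2}(n,m)$ be the group obtained from $G$ and $p$ by the Baer–Lovász–Tutte procedure (described in the context). Then $\kappa(G)=\kappa(P_G)$ and $\lambda(G)=\lambda(P_G)$.
   Context: For $i<j$, the elementary alternating matrix $A_{i,j}$ over a field $\mathbb{F}$ is the $n\times n$ matrix with $(i,j)$ entry $1$, $(j,i)$ entry $-1$, and all other entries $0$. Baer–Lovász–Tutte procedure: (1) set $\mathcal{A}_G=\langle A_{i,j}:\{i,j\}\in E\rangle$, an $m$-dimensional subspace of the space of $n\times n$ alternating matrices over $\mathbb{F}_p$; (2) choose an ordered basis $(A_1,\dots,A_m)$ of $\mathcal{A}_G$ and define the alternating bilinear map $\phi:\mathbb{F}_p^n\times\mathbb{F}_p^n\to\mathbb{F}_p^m$, $\phi(v,u)=(v^tA_1u,\dots,v^tA_mu)^t$; (3) let $P_G$ be the group with underlying set $\mathbb{F}_p^n\oplus\mathbb{F}_p^m$ and product $(v_1,u_1)\circ(v_2,u_2)=(v_1+v_2,\,u_1+u_2+\tfrac12\phi(v_1,v_2))$ (the isomorphism type does not depend on the chosen basis). $\mathfrak{B}_{p,2}(n,m)$ is the class of non-abelian finite groups $P$ of exponent $p$ with $[P,P]\leq \mathrm{Z}(P)$, $|P/[P,P]|=p^n$ and $|[P,P]|=p^m$. A group $H$ admits a central decomposition if there are non-trivial proper subgroups $J,K$ of $H$ with $[J,K]=1$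 and $H=JK$. A subgroup $S\leq P$ is regular if $[S,S]=S\cap[P,P]$. For $P\in\mathfrak{B}_{p,2}(n,m)$: $\kappa(P)$ is the smallest $s\in\mathbb{N}$ such that there is a regular subgroup $S\leq P$ with $|S/[S,S]|=p^{n-s}$ admitting a central decomposition; $\lambda(P)$ is the smallest $s\in\mathbb{N}$ such that there is a central subgroup $N$ of $P$ of order $p^s$ with $P/N$ admitting a central decomposition. For a graph $G$, the vertex connectivity $\kappa(G)$ is the smallest number of vertices whose removal disconnects $G$, and the edge connectivity $\lambda(G)$ is the smallest number of edges whose removal disconnects $G$. *)

theory Defs
  imports
    "HOL-Algebra.Generated_Groups"
    "HOL-Library.Extended_Nat"
    "Jordan_Normal_Form.VS_Connect"
    "Berlekamp_Zassenhaus.Finite_Field"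
begin

section \<open>Graphs\<close>

definition simple_graph :: "'v set \<Rightarrow> 'v set set \<Rightarrow> bool" where
  "simple_graph V E \<longleftrightarrow> finite V \<and> (\<forall>e\<in>E. e \<subseteq> V \<and> card e = 2)"

text \<open>Graphs with at most one vertex are connected. In particular no set of vertices
  disconnects a complete graph.\<close>

definition graph_connected :: "'v set \<Rightarrow> 'v set set \<Rightarrow> bool" where
  "graph_connected V E \<longleftrightarrow> (\<forall>u\<in>V. \<forall>v\<in>V. (u, v) \<in> {(x, y). {x, y} \<in> E}\<^sup>*)"

text \<open>All four connectivities take values in \<^typ>\<open>enat\<close>. A minimum over an empty set of numbers,
  as occurs for the vertex connectivity of complete graphs, is \<open>\<infinity>\<close>;
  otherwise the infimum is attained and is the usual minimum.\<close>

definition vertex_connectivity :: "'v set \<Rightarrow> 'v set set \<Rightarrow> enat" where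
  "vertex_connectivity V E =
     Inf {enat (card U) | U. U \<subseteq> V \<and> \<not> graph_connected (V - U) {e \<in> E. e \<inter> U = {}}}"

definition edge_connectivity :: "'v set \<Rightarrow> 'v set set \<Rightarrow> enat" where
  "edge_connectivity V E =
     Inf {enat (card F) | F. F \<subseteq> E \<and> \<not> graph_connected V (E - F)}"

section \<open>Groups\<close>

definition group_center :: "('a, 'b) monoid_scheme \<Rightarrow> 'a set" where
  "group_center G = {z \<in> carrier G. \<forall>x\<in>carrier G. z \<otimes>\<^bsub>G\<^esub> x = x \<otimes>\<^bsub>G\<^esub> z}"

definition group_exponent :: "('a, 'b) monoid_scheme \<Rightarrow> nat" where
  "group_exponent G = (LEAST e. 0 < e \<and> (\<forall>x\<in>carrier G. x [^]\<^bsub>G\<^esub> e = \<one>\<^bsub>G\<^esub>))"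

text \<open>The mutual commutator subgroup \<open>[J, K]\<close>, with the same commutator convention as
  \<^const>\<open>derived\<close>.\<close>

definition commutator_subgroup :: "('a, 'b) monoid_scheme \<Rightarrow> 'a set \<Rightarrow> 'a set \<Rightarrow> 'a set" where
  "commutator_subgroup G J K =
     generate G {j \<otimes>\<^bsub>G\<^esub> k \<otimes>\<^bsub>G\<^esub> inv\<^bsub>G\<^esub> j \<otimes>\<^bsub>G\<^esub> inv\<^bsub>G\<^esub> k | j k. j \<in> J \<and> k \<in> K}"

definition admits_central_decomposition :: "('a, 'b) monoid_scheme \<Rightarrow> bool" where
  "admits_central_decomposition H \<longleftrightarrow>
     (\<exists>J K. subgroup J H \<and> J \<noteq> {\<one>\<^bsub>H\<^esub>} \<and> J \<noteq> carrier H \<and>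
            subgroup K H \<and> K \<noteq> {\<one>\<^bsub>H\<^esub>} \<and> K \<noteq> carrier H \<and>
            commutator_subgroup H J K = {\<one>\<^bsub>H\<^esub>} \<and> carrier H = J <#>\<^bsub>H\<^esub> K)"

text \<open>The class \<open>\<BB>\<^bsub>p,2\<^esub>(n,m)\<close>.\<close>

definition baer_class :: "nat \<Rightarrow> nat \<Rightarrow> nat \<Rightarrow> 'a monoid set" where
  "baer_class p n m =
     {P. group P \<and> finite (carrier P) \<and> \<not> comm_group P \<and> group_exponent P = p \<and>
         derived P (carrier P) \<subseteq> group_center P \<and>
         Coset.order (P Mod derived P (carrier P)) = p ^ n \<and>
         card (derived P (carrier P)) = p ^ m}"

definition regular_subgroup :: "'a set \<Rightarrow> ('a, 'b) monoid_scheme \<Rightarrow> bool" where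
  "regular_subgroup S P \<longleftrightarrow> subgroup S P \<and> derived P S = S \<inter> derived P (carrier P)"

text \<open>In the next two definitions \<open>p\<close> and \<open>n\<close> are the parameters of the class
  \<^const>\<open>baer_class\<close> containing \<open>P\<close>; they are determined by \<open>P\<close>.\<close>

definition group_kappa :: "nat \<Rightarrow> nat \<Rightarrow> 'a monoid \<Rightarrow> enat" where
  "group_kappa p n P =
     Inf {enat s | s. s \<le> n \<and>
            (\<exists>S. regular_subgroup S P \<and>
                 Coset.order (P\<lparr>carrier := S\<rparr> Mod derived P S) = p ^ (n - s) \<and>
                 admits_central_decomposition (P\<lparr>carrier := S\<rparr>))}"

definition group_lambda :: "nat \<Rightarrow> 'a monoid \<Rightarrow> enat" where
  "group_lambda p P =
     Inf {enat s | s.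
            \<exists>N. subgroup N P \<and> N \<subseteq> group_center P \<and> card N = p ^ s \<and>
                admits_central_decomposition (P Mod N)}"

section \<open>The Baer-Lovasz-Tutte procedure\<close>

text \<open>Vertices are numbered from 1, whereas rows and columns of \<^typ>\<open>'a mat\<close> are numbered
  from 0.\<close>

definition elementary_alternating :: "nat \<Rightarrow> nat \<Rightarrow> nat \<Rightarrow> 'a::field mat" where
  "elementary_alternating n i j =
     mat n n (\<lambda>(r, c). if (Suc r, Suc c) = (i, j) then 1
                       else if (Suc r, Suc c) = (j, i) then - 1 else 0)"

definition graph_alternating_space :: "nat \<Rightarrow> nat set set \<Rightarrow> 'a::field mat set" where
  "graph_alternating_space n E =
     LinearCombinations.module.span class_ring (module_mat TYPE('a) n n)
       {elementary_alternating n i j | i j. i < j \<and> {i, j} \<in> E}"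

definition ordered_basis_of :: "nat \<Rightarrow> 'a::field mat set \<Rightarrow> 'a mat list \<Rightarrow> bool" where
  "ordered_basis_of n W As \<longleftrightarrow>
     distinct As \<and> vectorspace.basis class_ring ((module_mat TYPE('a) n n)\<lparr>carrier := W\<rparr>) (set As)"

definition alternating_form :: "'a::field mat list \<Rightarrow> 'a vec \<Rightarrow> 'a vec \<Rightarrow> 'a vec" where
  "alternating_form As v u = vec (length As) (\<lambda>k. v \<bullet> (As ! k *\<^sub>v u))"

definition baer_group :: "nat \<Rightarrow> 'a::field mat list \<Rightarrow> ('a vec \<times> 'a vec) monoid" where
  "baer_group n As =
     \<lparr>carrier = carrier_vec n \<times> carrier_vec (length As),
      monoid.mult = (\<lambda>(v1, u1) (v2, u2). (v1 + v2, u1 + u2 + (1 / 2) \<cdot>\<^sub>v alternating_form As v1 v2)),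
      one = (0\<^sub>v n, 0\<^sub>v (length As))\<rparr>"

end

theory Submission
  imports Defs
begin

text \<open>
  The commutator of \<open>(v\<^sub>1, u\<^sub>1)\<close> and \<open>(v\<^sub>2, u\<^sub>2)\<close> in \<open>P\<^sub>G\<close> is \<open>(0, \<phi>(v\<^sub>1, v\<^sub>2))\<close>, so central
  decompositions of regular subgroups and of central quotients are governed by proper subspaces
  \<open>U\<^sub>1 + U\<^sub>2 = U\<close> of \<open>\<F>\<^sub>p\<^sup>n\<close> with \<open>\<phi>(U\<^sub>1, U\<^sub>2) = 0\<close>, respectively \<open>\<phi>(U\<^sub>1, U\<^sub>2)\<close> small. A cut of
  \<open>G\<close> gives such coordinate subspaces. Conversely:

  For \<open>\<kappa>\<close>, a minimal set \<open>C\<close> of coordinates that is injective on \<open>U\<close> has at least \<open>dim U\<close>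
  elements, and no two of them are proportional on \<open>U\<close>. Split \<open>C\<close> into nonempty parts \<open>C\<^sub>1\<close>, \<open>C\<^sub>2\<close> of
  coordinates not vanishing on \<open>U\<^sub>1\<close> and \<open>U\<^sub>2\<close>. An edge between \<open>i \<in> C\<^sub>1\<close> and \<open>j \<in> C\<^sub>2\<close> would force
  \<open>u\<^sub>i v\<^sub>j = u\<^sub>j v\<^sub>i\<close> on \<open>U\<^sub>1 \<times> U\<^sub>2\<close>, making the coordinates \<open>i\<close> and \<open>j\<close> proportional on \<open>U\<close>.

  For \<open>\<lambda>\<close>, decompose each unit vector along \<open>U\<^sub>1 + U\<^sub>2 = \<F>\<^sub>p\<^sup>n\<close>. If some component has an
  off-diagonal entry \<open>i\<close>, then already the edges at \<open>i\<close> give linearly independent values of \<open>\<phi>\<close> on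
  \<open>U\<^sub>1 \<times> U\<^sub>2\<close>, and removing them isolates \<open>i\<close>. Otherwise each unit vector lies in \<open>U\<^sub>1\<close> or \<open>U\<^sub>2\<close>, and
  the edges between the two classes do.
\<close>

section \<open>Graphs and coordinate subspaces\<close>

lemma not_graph_connectedI:
  assumes "a \<in> V" "b \<in> V" "a \<in> X" "b \<notin> X"
    and closed: "\<And>x y. {x, y} \<in> E \<Longrightarrow> x \<in> X \<Longrightarrow> y \<in> X"
  shows "\<not> graph_connected V E"
proof
  assume "graph_connected V E"
  then have "(a, b) \<in> {(x, y). {x, y} \<in> E}\<^sup>*"
    using assms(1,2) unfolding graph_connected_def by blast
  then have "b \<in> X"
    by (induction rule: rtrancl_induct) (use \<open>a \<in> X\<close> closed in auto)
  with \<open>b \<notin> X\<close> show False by contradiction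
qed

text \<open>The side \<open>X\<close> is the set of vertices reachable from \<open>a\<close>. Edges
  are unordered, so reachability passes along an edge in both directions, which gives an equivalence
  rather than a one-way closure.\<close>

lemma not_graph_connectedE:
  assumes "\<not> graph_connected V E"
  obtains X a b where "a \<in> V" "b \<in> V" "a \<in> X" "b \<notin> X"
    and "\<forall>x y. {x, y} \<in> E \<longrightarrow> (x \<in> X \<longleftrightarrow> y \<in> X)"
proof -
  let ?R = "{(x, y). {x, y} \<in> E}"
  obtain a b where ab: "a \<in> V" "b \<in> V" "(a, b) \<notin> ?R\<^sup>*"
    using assms unfolding graph_connected_def by blast
  have step: "(a, y) \<in> ?R\<^sup>*" if "{x, y} \<in> E" "(a, x) \<in> ?R\<^sup>*" for x y
    using that by (auto intro: rtrancl.rtrancl_into_rtrancl)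
  show thesis
  proof (rule that[of a b "{x. (a, x) \<in> ?R\<^sup>*}"])
    show "\<forall>x y. {x, y} \<in> E \<longrightarrow> (x \<in> {x. (a, x) \<in> ?R\<^sup>*} \<longleftrightarrow> y \<in> {x. (a, x) \<in> ?R\<^sup>*})"
    proof (intro allI impI)
      fix x y assume "{x, y} \<in> E"
      then show "x \<in> {x. (a, x) \<in> ?R\<^sup>*} \<longleftrightarrow> y \<in> {x. (a, x) \<in> ?R\<^sup>*}"
        using step[of x y] step[of y x] by (auto simp: insert_commute)
    qed
  qed (use ab in auto)
qed

lemma simple_graph_finite_edges:
  assumes "simple_graph V E"
  shows "finite E"
  using assms unfolding simple_graph_def by (meson Pow_iff finite_Pow_iff finite_subset subsetI)

section \<open>Linear subspaces as plain sets of vectors\<close>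

definition vec_subspace :: "nat \<Rightarrow> 'a::field vec set \<Rightarrow> bool" where
  "vec_subspace n U \<longleftrightarrow> U \<subseteq> carrier_vec n \<and> 0\<^sub>v n \<in> U \<and>
     (\<forall>u\<in>U. \<forall>v\<in>U. u + v \<in> U) \<and> (\<forall>c. \<forall>u\<in>U. c \<cdot>\<^sub>v u \<in> U)"

lemma vec_subspace_carrier: "vec_subspace n U \<Longrightarrow> u \<in> U \<Longrightarrow> u \<in> carrier_vec n"
  unfolding vec_subspace_def by blast

lemma vec_subspace_dim: "vec_subspace n U \<Longrightarrow> u \<in> U \<Longrightarrow> dim_vec u = n"
  using vec_subspace_carrier by fastforce

lemma vec_subspace_zero: "vec_subspace n U \<Longrightarrow> 0\<^sub>v n \<in> U"
  unfolding vec_subspace_def by blast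

lemma vec_subspace_add: "vec_subspace n U \<Longrightarrow> u \<in> U \<Longrightarrow> v \<in> U \<Longrightarrow> u + v \<in> U"
  unfolding vec_subspace_def by blast

lemma vec_subspace_smult: "vec_subspace n U \<Longrightarrow> u \<in> U \<Longrightarrow> c \<cdot>\<^sub>v u \<in> U"
  unfolding vec_subspace_def by blast

lemma vec_subspace_add_smult:
  "vec_subspace n U \<Longrightarrow> u \<in> U \<Longrightarrow> v \<in> U \<Longrightarrow> u + c \<cdot>\<^sub>v v \<in> U"
  by (intro vec_subspace_add vec_subspace_smult)

lemma vec_subspace_sum:
  assumes "vec_subspace n U1" "vec_subspace n U2"
  shows "vec_subspace n {u + v | u v. u \<in> U1 \<and> v \<in> U2}"
  unfolding vec_subspace_def
proof (intro conjI ballI allI)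
  note c = vec_subspace_carrier[OF assms(1)] vec_subspace_carrier[OF assms(2)]
  show "{u + v | u v. u \<in> U1 \<and> v \<in> U2} \<subseteq> carrier_vec n" using c by auto
  show "0\<^sub>v n \<in> {u + v | u v. u \<in> U1 \<and> v \<in> U2}"
    using assms[THEN vec_subspace_zero] by force
  fix x assume "x \<in> {u + v | u v. u \<in> U1 \<and> v \<in> U2}"
  then obtain u v where x: "x = u + v" "u \<in> U1" "v \<in> U2" by auto
  show "a \<cdot>\<^sub>v x \<in> {u + v | u v. u \<in> U1 \<and> v \<in> U2}" for a
    using x assms smult_add_distrib_vec[OF c(1) c(2)] by (blast intro: vec_subspace_smult)
  fix y assume "y \<in> {u + v | u v. u \<in> U1 \<and> v \<in> U2}"
  then obtain u' v' where y: "y = u' + v'" "u' \<in> U1" "v' \<in> U2" by auto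
  have "x + y = (u + u') + (v + v')"
    using x y c by (auto simp: vec_subspace_dim[OF assms(1)] vec_subspace_dim[OF assms(2)])
  then show "x + y \<in> {u + v | u v. u \<in> U1 \<and> v \<in> U2}"
    using x y assms by (blast intro: vec_subspace_add)
qed

lemma vec_subspace_subset_sum:
  assumes U1: "vec_subspace n U1" and U2: "vec_subspace n U2"
  shows "U1 \<subseteq> {u + v | u v. u \<in> U1 \<and> v \<in> U2}" "U2 \<subseteq> {u + v | u v. u \<in> U1 \<and> v \<in> U2}"
proof -
  have "u = u + 0\<^sub>v n" if "u \<in> U1" for u
    using vec_subspace_carrier[OF U1 that] by simp
  then show "U1 \<subseteq> {u + v | u v. u \<in> U1 \<and> v \<in> U2}"
    using vec_subspace_zero[OF U2] by blast
  have "u = 0\<^sub>v n + u" if "u \<in> U2" for u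
    using vec_subspace_carrier[OF U2 that] by simp
  then show "U2 \<subseteq> {u + v | u v. u \<in> U1 \<and> v \<in> U2}"
    using vec_subspace_zero[OF U1] by blast
qed

text \<open>Induction on \<open>k\<close> shows that vectors supported on the first \<open>k\<close>
  positions lie in \<open>U\<close>: subtracting a multiple of the last unit vector lowers
  \<open>k\<close>. The hypothesis numbers vertices from 1, positions start at 0.\<close>

lemma vec_subspace_eq_carrier:
  fixes U :: "'a::field vec set"
  assumes U: "vec_subspace n U" and unit: "\<And>i. i \<in> {1..n} \<Longrightarrow> unit_vec n (i - 1) \<in> U"
  shows "U = carrier_vec n"
proof -
  have "v \<in> U" if "k \<le> n" "v \<in> carrier_vec n" "\<And>i. k \<le> i \<Longrightarrow> i < n \<Longrightarrow> v $ i = 0" for v k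
    using that
  proof (induction k arbitrary: v)
    case 0
    then have "v = 0\<^sub>v n" by auto
    then show ?case using vec_subspace_zero[OF U] by simp
  next
    case (Suc k)
    define w where "w = v - v $ k \<cdot>\<^sub>v unit_vec n k"
    have "w \<in> U"
      using Suc.prems by (intro Suc.IH) (auto simp: w_def unit_vec_def Suc_le_eq)
    moreover have "unit_vec n k \<in> U" using unit[of "Suc k"] Suc.prems(1) by simp
    ultimately have "w + v $ k \<cdot>\<^sub>v unit_vec n k \<in> U" by (rule vec_subspace_add_smult[OF U])
    moreover have "w + v $ k \<cdot>\<^sub>v unit_vec n k = v" using Suc.prems(2) by (auto simp: w_def)
    ultimately show ?case by simp
  qed
  from this[of n] show ?thesis using vec_subspace_carrier[OF U] by auto
qed

section \<open>From a pair of orthogonal subspaces to a vertex cut\<close>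

lemma zero_vecI_coords:
  assumes "v \<in> carrier_vec n" "\<And>i. i \<in> {1..n} \<Longrightarrow> v $ (i - 1) = 0"
  shows "v = 0\<^sub>v n"
proof (rule eq_vecI)
  fix k assume "k < dim_vec (0\<^sub>v n :: 'a vec)"
  then show "v $ k = 0\<^sub>v n $ k" using assms(2)[of "Suc k"] by auto
qed (use assms in auto)

text \<open>The difference has the shape that \<open>vec_subspace_add_smult\<close> produces, so
  vectors of a subspace are compared by showing that a combination in the subspace vanishes on
  enough coordinates.\<close>

lemma eq_smult_vecI:
  fixes w u :: "'a::field vec"
  assumes d: "dim_vec w = n" "dim_vec u = n" and eq: "w + (- c) \<cdot>\<^sub>v u = 0\<^sub>v n"
  shows "w = c \<cdot>\<^sub>v u"
proof (rule eq_vecI)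
  fix k assume "k < dim_vec (c \<cdot>\<^sub>v u)"
  then have "k < n" using d by simp
  moreover have "(w + (- c) \<cdot>\<^sub>v u) $ k = 0\<^sub>v n $ k" by (simp only: eq)
  ultimately show "w $ k = (c \<cdot>\<^sub>v u) $ k" using d by simp
qed (use d in simp)

text \<open>The cardinality says that \<open>U\<close> has dimension \<open>n - s\<close>, and
  \<open>orth\<close> that every edge form vanishes on \<open>U1 \<times> U2\<close>. The removed
  set is the complement of a minimal determining set \<open>C\<close> of coordinates, so at least
  \<open>n - s\<close> vertices survive.\<close>

lemma vertex_cut_of_orthogonal_subspaces:
  fixes U1 U2 :: "'a::{field,finite} vec set"
  assumes E: "simple_graph {1..n} E"
    and U1: "vec_subspace n U1" and U2: "vec_subspace n U2"
    and U: "U = {u + v | u v. u \<in> U1 \<and> v \<in> U2}"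
    and ne: "U1 \<noteq> U" "U2 \<noteq> U"
    and orth: "\<And>i j u v. {i, j} \<in> E \<Longrightarrow> u \<in> U1 \<Longrightarrow> v \<in> U2 \<Longrightarrow>
      u $ (i - 1) * v $ (j - 1) = u $ (j - 1) * v $ (i - 1)"
    and card: "card U = CARD('a) ^ (n - s)"
  shows "\<exists>W\<subseteq>{1..n}. card W \<le> s \<and> \<not> graph_connected ({1..n} - W) {e \<in> E. e \<inter> W = {}}"
proof -
  have US: "vec_subspace n U" unfolding U by (rule vec_subspace_sum[OF U1 U2])
  have U1U: "U1 \<subseteq> U" and U2U: "U2 \<subseteq> U"
    unfolding U by (rule vec_subspace_subset_sum[OF U1 U2])+
  \<comment> \<open>\<open>sep C\<close> says that a vector of \<open>U\<close> is determined by its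
    coordinates in \<open>C\<close>. A set of least cardinality with this property is chosen
    below.\<close>
  define sep where "sep C \<longleftrightarrow> C \<subseteq> {1..n} \<and> (\<forall>w\<in>U. (\<forall>i\<in>C. w $ (i - 1) = 0) \<longrightarrow> w = 0\<^sub>v n)" for C
  have "sep {1..n}" unfolding sep_def
    using zero_vecI_coords vec_subspace_carrier[OF US] by blast
  then obtain C where C: "sep C" and Cmin: "\<And>C'. sep C' \<Longrightarrow> card C \<le> card C'"
    using ex_has_least_nat[of sep "{1..n}" card] by blast
  have Csub: "C \<subseteq> {1..n}" and Cz: "\<And>w. w \<in> U \<Longrightarrow> (\<And>i. i \<in> C \<Longrightarrow> w $ (i - 1) = 0) \<Longrightarrow> w = 0\<^sub>v n"
    using C unfolding sep_def by blast+
  have Clt: "i - 1 < n" if "i \<in> C" for i using subsetD[OF Csub that] by auto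
  have fC: "finite C" using Csub finite_subset by blast
  \<comment> \<open>Minimality: dropping one coordinate admits a nonzero vector of \<open>U\<close>
    that vanishes on the rest of \<open>C\<close>. Both the covering of \<open>C\<close> by
    \<open>A\<close> and \<open>B\<close> and the absence of edges rest on this.\<close>
  have nsep: "\<not> sep (C - {i})" if "i \<in> C" for i
    using Cmin[of "C - {i}"] fC that by (metis card_Diff1_less leD)

  have "card U \<le> card (C \<rightarrow>\<^sub>E (UNIV :: 'a set))"
  proof (rule card_inj_on_le)
    show "inj_on (\<lambda>w. restrict (\<lambda>i. w $ (i - 1)) C) U"
    proof (rule inj_onI)
      fix w w' assume w: "w \<in> U" "w' \<in> U"
        and eq: "restrict (\<lambda>i. w $ (i - 1)) C = restrict (\<lambda>i. w' $ (i - 1)) C"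
      note d = vec_subspace_dim[OF US w(1)] vec_subspace_dim[OF US w(2)]
      have "w + (- 1) \<cdot>\<^sub>v w' = 0\<^sub>v n"
      proof (rule Cz)
        show "w + (- 1) \<cdot>\<^sub>v w' \<in> U" using vec_subspace_add_smult[OF US w] .
        fix i assume "i \<in> C"
        then have "w $ (i - 1) = w' $ (i - 1)" "i - 1 < n"
          using fun_cong[OF eq, of i] Clt[of i] by auto
        then show "(w + (- 1) \<cdot>\<^sub>v w') $ (i - 1) = 0" using d by simp
      qed
      from eq_smult_vecI[OF d this] show "w = w'" by simp
    qed
  qed (use fC in \<open>auto intro: finite_PiE\<close>)
  then have "CARD('a) ^ (n - s) \<le> CARD('a) ^ card C"
    using fC by (simp add: card card_PiE)
  moreover have "1 < CARD('a)"
  proof -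
    have "card {0, 1::'a} \<le> CARD('a)" by (rule card_mono) auto
    then show ?thesis by simp
  qed
  ultimately have "n - s \<le> card C" by (simp add: power_increasing_iff)
  define W where "W = {1..n} - C"
  have W: "W \<subseteq> {1..n}" "{1..n} - W = C" using Csub by (auto simp: W_def)
  have "card W = n - card C" using Csub fC by (simp add: W_def card_Diff_subset)
  then have Ws: "card W \<le> s" using \<open>n - s \<le> card C\<close> by simp

  define A where "A = {i \<in> C. \<exists>u\<in>U1. u $ (i - 1) \<noteq> 0}"
  define B where "B = {i \<in> C. \<exists>u\<in>U2. u $ (i - 1) \<noteq> 0}"
  \<comment> \<open>The vector given by minimality has \<open>i\<close> as its only nonzero
    coordinate in \<open>C\<close>, so one of its components in \<open>U1\<close> and
    \<open>U2\<close> is nonzero there.\<close>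
  have AB: "i \<in> A \<or> i \<in> B" if i: "i \<in> C" for i
  proof -
    obtain w where w: "w \<in> U" "w \<noteq> 0\<^sub>v n" "\<And>k. k \<in> C - {i} \<Longrightarrow> w $ (k - 1) = 0"
      using nsep[OF i] Csub unfolding sep_def by blast
    have "w $ (i - 1) \<noteq> 0" using Cz[OF w(1)] w(2,3) by blast
    moreover obtain u v where uv: "u \<in> U1" "v \<in> U2" "w = u + v" using w(1) U by auto
    moreover have "i - 1 < n" using Clt[OF i] .
    ultimately have "u $ (i - 1) \<noteq> 0 \<or> v $ (i - 1) \<noteq> 0"
      using vec_subspace_dim[OF U1 uv(1)] vec_subspace_dim[OF U2 uv(2)] by auto
    with i uv show ?thesis unfolding A_def B_def by blast
  qed
  \<comment> \<open>If all coordinates in \<open>C\<close> vanish on \<open>U1\<close>, then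
    \<open>U1\<close> is zero and \<open>U = U2\<close>, against properness. The argument for
    \<open>B\<close> is symmetric.\<close>
  have "A \<noteq> {}"
  proof
    assume "A = {}"
    then have z: "u = 0\<^sub>v n" if "u \<in> U1" for u
      using Cz[of u] that U1U by (auto simp: A_def)
    have "U \<subseteq> U2" unfolding U using z vec_subspace_carrier[OF U2] by force
    with ne U2U show False by blast
  qed
  moreover have "B \<noteq> {}"
  proof
    assume "B = {}"
    then have z: "u = 0\<^sub>v n" if "u \<in> U2" for u
      using Cz[of u] that U2U by (auto simp: B_def)
    have "U \<subseteq> U1" unfolding U using z vec_subspace_carrier[OF U1] by force
    with ne U1U show False by blast
  qed
  \<comment> \<open>A single determining coordinate makes \<open>U\<close> a line. A vector of
    \<open>U1\<close> with nonzero coordinate \<open>i\<close> then spans it, so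
    \<open>U1 = U\<close>.\<close>
  moreover have "C \<noteq> {i}" if i: "i \<in> A" for i
  proof
    assume Ci: "C = {i}"
    obtain u where u: "u \<in> U1" "u $ (i - 1) \<noteq> 0" using i unfolding A_def by blast
    have "w \<in> U1" if w: "w \<in> U" for w
    proof -
      let ?c = "w $ (i - 1) / u $ (i - 1)"
      note d = vec_subspace_dim[OF US w] vec_subspace_dim[OF U1 u(1)]
      have "w + (- ?c) \<cdot>\<^sub>v u = 0\<^sub>v n"
      proof (rule Cz)
        show "w + (- ?c) \<cdot>\<^sub>v u \<in> U"
          using w u U1U by (intro vec_subspace_add_smult[OF US]) auto
        fix k assume "k \<in> C"
        then have "k = i" "i - 1 < n" using Ci Clt[of i] by auto
        then show "(w + (- ?c) \<cdot>\<^sub>v u) $ (k - 1) = 0" using d u by simp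
      qed
      then have "w = ?c \<cdot>\<^sub>v u" by (rule eq_smult_vecI[OF d])
      then show ?thesis using vec_subspace_smult[OF U1 u(1)] by metis
    qed
    with ne U1U show False by blast
  qed
  ultimately obtain a0 b0 where ab0: "a0 \<in> A" "b0 \<in> B" "C \<noteq> {a0}" by blast
  have "\<exists>a b. a \<in> A \<and> b \<in> B \<and> a \<noteq> b"
  proof (cases "a0 = b0")
    case True
    obtain c where "c \<in> C" "c \<noteq> a0" using ab0 by (auto simp: A_def)
    with AB ab0 True show ?thesis by blast
  qed (use ab0 in blast)
  then obtain a b where ab: "a \<in> A" "b \<in> B" "a \<noteq> b" by blast
  \<comment> \<open>\<open>A\<close> and \<open>B\<close> may overlap. With \<open>b\<close> moved
    to the other side, \<open>X\<close> and \<open>C - X\<close> partition \<open>C\<close>, contain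
    \<open>a\<close> and \<open>b\<close> respectively, and \<open>C - X\<close> stays inside
    \<open>B\<close>.\<close>
  define X where "X = A - {b}"
  have XB: "j \<in> B" if "j \<in> C - X" for j using that AB[of j] ab by (auto simp: X_def)
  have noedge: "{i, j} \<notin> E" if i: "i \<in> X" and j: "j \<in> C - X" for i j
  proof
    assume e: "{i, j} \<in> E"
    obtain u v where u: "u \<in> U1" "u $ (i - 1) \<noteq> 0" and v: "v \<in> U2" "v $ (j - 1) \<noteq> 0"
      using i XB[OF j] by (auto simp: X_def A_def B_def)
    let ?c = "u $ (j - 1) / u $ (i - 1)"
    \<comment> \<open>Orthogonality of \<open>u\<close> and \<open>v\<close> reads
      \<open>u_i v_j = u_j v_i\<close> with nonzero left side, so the ratio \<open>?c\<close> is the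
      same whether computed from \<open>u\<close> or from \<open>v\<close>. Pairing with
      \<open>v\<close> then fixes this ratio on all of \<open>U1\<close>, pairing with
      \<open>u\<close> on all of \<open>U2\<close>.\<close>
    have v0: "v $ (i - 1) \<noteq> 0" using orth[OF e u(1) v(1)] u v by auto
    have c: "?c = v $ (j - 1) / v $ (i - 1)"
      using orth[OF e u(1) v(1)] u v v0 by (simp add: field_simps)
    have 1: "u' $ (j - 1) = ?c * u' $ (i - 1)" if "u' \<in> U1" for u'
      unfolding c using orth[OF e that v(1)] v0 by (simp add: field_simps)
    have 2: "v' $ (j - 1) = ?c * v' $ (i - 1)" if "v' \<in> U2" for v'
      using orth[OF e u(1) that] u(2) by (simp add: field_simps)
    have iC: "i \<in> C" "i \<noteq> j" using i j by (auto simp: X_def A_def)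
    have ratio: "w $ (j - 1) = ?c * w $ (i - 1)" if w: "w \<in> U" for w
    proof -
      obtain u' v' where uv: "u' \<in> U1" "v' \<in> U2" "w = u' + v'" using w U by auto
      moreover have "i - 1 < n" "j - 1 < n" using Clt[of i] Clt[of j] iC j by auto
      ultimately show ?thesis
        using 1[OF uv(1)] 2[OF uv(2)] vec_subspace_dim[OF U1 uv(1)] vec_subspace_dim[OF U2 uv(2)]
        by (simp add: distrib_left)
    qed
    \<comment> \<open>Coordinate \<open>j\<close> is a multiple of coordinate \<open>i\<close> on
      \<open>U\<close>, so \<open>C\<close> without \<open>j\<close> would still determine the
      vectors of \<open>U\<close>.\<close>
    have "sep (C - {j})" unfolding sep_def
    proof (intro conjI ballI impI)
      fix w assume w: "w \<in> U" "\<forall>k\<in>C - {j}. w $ (k - 1) = 0"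
      then have "w $ (i - 1) = 0" using iC by blast
      then have "w $ (j - 1) = 0" using ratio[OF w(1)] by simp
      then show "w = 0\<^sub>v n" using Cz[OF w(1)] w(2) by blast
    qed (use Csub in auto)
    with nsep j show False by blast
  qed
  have "\<not> graph_connected ({1..n} - W) {e \<in> E. e \<inter> W = {}}"
  proof (rule not_graph_connectedI[of a _ b X])
    fix x y assume xy: "{x, y} \<in> {e \<in> E. e \<inter> W = {}}" "x \<in> X"
    then have "{x, y} \<subseteq> {1..n} - W" using E unfolding simple_graph_def by blast
    then have "y \<in> C" unfolding W(2) by blast
    then show "y \<in> X" using noedge[of x y] xy by blast
  qed (use ab W in \<open>auto simp: X_def A_def B_def\<close>)
  with W Ws show ?thesis by blast
qed

section \<open>From a pair of subspaces spanning the whole space to an edge cut\<close>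

definition edge_form :: "'a::field vec \<Rightarrow> 'a vec \<Rightarrow> nat set \<Rightarrow> 'a" where
  "edge_form u v e = u $ (Min e - 1) * v $ (Max e - 1) - u $ (Max e - 1) * v $ (Min e - 1)"

text \<open>\<open>edge_form\<close> orients an edge from its smaller to its larger endpoint. With
  the endpoints named in arbitrary order the value is the 2 by 2 minor up to sign.\<close>

lemma edge_form_eq:
  assumes "i \<noteq> k"
  shows "edge_form u v {i, k} = (if i < k then 1 else - 1) * (u $ (i - 1) * v $ (k - 1) - u $ (k - 1) * v $ (i - 1))"
  using assms by (auto simp: edge_form_def min_def max_def)

text \<open>\<open>N\<close> is a vector space of functions whose restrictions to \<open>F\<close>
  include every unit function, hence all functions on \<open>F\<close>. In terms of dimensions,
  \<open>card F \<le> dim N\<close>.\<close>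

lemma card_ge_of_unit_functions:
  fixes N :: "('b \<Rightarrow> 'a::{field,finite}) set"
  assumes fin: "finite N" "finite F"
    and z: "(\<lambda>_. 0) \<in> N"
    and add: "\<And>f g. f \<in> N \<Longrightarrow> g \<in> N \<Longrightarrow> (\<lambda>e. f e + g e) \<in> N"
    and smult: "\<And>c f. f \<in> N \<Longrightarrow> (\<lambda>e. c * f e) \<in> N"
    and unit: "\<And>e. e \<in> F \<Longrightarrow> \<exists>g\<in>N. \<forall>e'\<in>F. g e' = of_bool (e' = e)"
  shows "CARD('a) ^ card F \<le> card N"
proof -
  obtain g where g: "\<And>e. e \<in> F \<Longrightarrow> g e \<in> N" "\<And>e e'. e \<in> F \<Longrightarrow> e' \<in> F \<Longrightarrow> g e e' = of_bool (e' = e)"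
    using unit by metis
  have sum_in: "(\<lambda>x. \<Sum>e\<in>A. f e * g e x) \<in> N" if "A \<subseteq> F" for A and f :: "'b \<Rightarrow> 'a"
    using finite_subset[OF that fin(2)] that
  proof (induction A rule: finite_induct)
    case (insert a A)
    then have "(\<lambda>x. \<Sum>e\<in>A. f e * g e x) \<in> N" "a \<in> F" by auto
    from add[OF smult[OF g(1)[OF this(2)], of "f a"] this(1)]
    have "(\<lambda>x. f a * g a x + (\<Sum>e\<in>A. f e * g e x)) \<in> N" .
    then show ?case unfolding sum.insert[OF insert.hyps(1,2)] .
  qed (use z in simp)
  \<comment> \<open>A function on \<open>F\<close> is the combination of the functions
    \<open>g e\<close> with its own values as coefficients.\<close>
  have "(F \<rightarrow>\<^sub>E (UNIV :: 'a set)) \<subseteq> (\<lambda>h. restrict h F) ` N"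
  proof
    fix f :: "'b \<Rightarrow> 'a" assume f: "f \<in> F \<rightarrow>\<^sub>E UNIV"
    have expand: "f x = (\<Sum>e\<in>F. f e * g e x)" if "x \<in> F" for x
    proof -
      have "(\<Sum>e\<in>F. f e * g e x) = (\<Sum>e\<in>F. if e = x then f e else 0)"
        using that by (intro sum.cong) (auto simp: g(2))
      then show ?thesis using that fin(2) by (simp add: sum.delta)
    qed
    have "f = restrict (\<lambda>x. \<Sum>e\<in>F. f e * g e x) F"
    proof
      fix x show "f x = restrict (\<lambda>x. \<Sum>e\<in>F. f e * g e x) F x"
        using expand[of x] PiE_arb[OF f, of x] by (cases "x \<in> F") simp_all
    qed
    with sum_in[of F f] show "f \<in> (\<lambda>h. restrict h F) ` N" by blast
  qed
  then have "card (F \<rightarrow>\<^sub>E (UNIV :: 'a set)) \<le> card N"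
    using fin(1) by (meson surj_card_le)
  then show ?thesis using fin(2) by (simp add: card_PiE)
qed

text \<open>\<open>N\<close> is a linear space of functions on edges that contains the values of the
  form on \<open>U1 \<times> U2\<close>. It suffices to find in \<open>N\<close> a unit function for
  every edge of a cut \<open>F\<close>, since then \<open>card F\<close> is at most the dimension of
  \<open>N\<close>.\<close>

lemma edge_cut_of_complementary_subspaces:
  fixes U1 U2 :: "'a::{field,finite} vec set" and N :: "(nat set \<Rightarrow> 'a) set"
  assumes E: "simple_graph {1..n} E"
    and U1: "vec_subspace n U1" and U2: "vec_subspace n U2"
    and sum: "carrier_vec n = {u + v | u v. u \<in> U1 \<and> v \<in> U2}"
    and ne: "U1 \<noteq> carrier_vec n" "U2 \<noteq> carrier_vec n"
    and fin: "finite N"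
    and z: "(\<lambda>_. 0) \<in> N"
    and add: "\<And>f g. f \<in> N \<Longrightarrow> g \<in> N \<Longrightarrow> (\<lambda>e. f e + g e) \<in> N"
    and smult: "\<And>c f. f \<in> N \<Longrightarrow> (\<lambda>e. c * f e) \<in> N"
    and form: "\<And>u v. u \<in> U1 \<Longrightarrow> v \<in> U2 \<Longrightarrow> \<exists>g\<in>N. \<forall>e\<in>E. g e = edge_form u v e"
  shows "\<exists>F\<subseteq>E. CARD('a) ^ card F \<le> card N \<and> \<not> graph_connected {1..n} (E - F)"
proof -
  have finE: "finite E" by (rule simple_graph_finite_edges[OF E])
  have edgeE: "\<exists>k. e = {i, k} \<and> i \<noteq> k \<and> k \<in> {1..n}" if "e \<in> E" "i \<in> e" for e i
  proof -
    have "card e = 2" "e \<subseteq> {1..n}" using E that unfolding simple_graph_def by auto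
    with \<open>i \<in> e\<close> show ?thesis by (auto simp: card_2_iff)
  qed
  have split: "\<exists>u v. u \<in> U1 \<and> v \<in> U2 \<and> (\<forall>l\<in>{1..n}. u $ (l - 1) + v $ (l - 1) = of_bool (l = j))"
    if j: "j \<in> {1..n}" for j
  proof -
    have "unit_vec n (j - 1) \<in> (carrier_vec n :: 'a vec set)" by simp
    then obtain u v where uv: "u \<in> U1" "v \<in> U2" "unit_vec n (j - 1) = u + v"
      unfolding sum by blast
    have "u $ (l - 1) + v $ (l - 1) = of_bool (l = j)" if "l \<in> {1..n}" for l
    proof -
      have "(u + v) $ (l - 1) = unit_vec n (j - 1) $ (l - 1)" using uv by simp
      moreover have "l - 1 < n" using that by auto
      moreover have "(l - 1 = j - 1) = (l = j)" using that j by auto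
      ultimately show ?thesis
        using j vec_subspace_dim[OF U2 uv(2)] by (simp add: unit_vec_def)
    qed
    with uv show ?thesis by blast
  qed
  \<comment> \<open>Let \<open>e_j = u + v\<close> and \<open>e_k = a + b\<close> with
    \<open>i\<close> different from \<open>j\<close> and \<open>k\<close>, so that
    \<open>v_i = - u_i\<close> and \<open>b_i = - a_i\<close>. On the edge \<open>{i, l}\<close> the
    forms of \<open>(u, b)\<close> and \<open>(a, v)\<close> add up to
    \<open>s * (u_i * [l = k] + a_i * [l = j])\<close>, and the multiple of the form of
    \<open>(u, v)\<close> cancels the second term. Here \<open>x\<close> is \<open>u_i\<close> and
    \<open>s\<close> the orientation sign.\<close>
  have identity: "s * (x * (dk - al) - ul * - ai) + s * (ai * (dj - ul) - al * - x) +
      - (ai / x) * (s * (x * (dj - ul) - ul * - x)) = s * (x * dk)"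
    if x: "x \<noteq> 0" for s x dk al ul ai dj :: 'a
  proof -
    have "x * (dj - ul) - ul * - x = x * dj" by (simp add: algebra_simps)
    moreover have "- (ai / x) * (s * (x * dj)) = - (ai * s * dj)" using x by simp
    ultimately have "- (ai / x) * (s * (x * (dj - ul) - ul * - x)) = - (ai * s * dj)"
      by (simp only:)
    then show ?thesis by (simp only:) (simp add: algebra_simps)
  qed
  show ?thesis
  proof (cases "\<exists>i\<in>{1..n}. \<exists>j\<in>{1..n}. i \<noteq> j \<and> (\<exists>u\<in>U1. \<exists>v\<in>U2. u $ (i - 1) \<noteq> 0 \<and>
            (\<forall>l\<in>{1..n}. u $ (l - 1) + v $ (l - 1) = of_bool (l = j)))")
    case True
    then obtain i j u v where i: "i \<in> {1..n}" and j: "j \<in> {1..n}" and ij: "i \<noteq> j"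
      and u: "u \<in> U1" "u $ (i - 1) \<noteq> 0" and v: "v \<in> U2"
      and uv: "\<And>l. l \<in> {1..n} \<Longrightarrow> u $ (l - 1) + v $ (l - 1) = of_bool (l = j)"
      by blast
    \<comment> \<open>The star of \<open>i\<close>: its removal separates \<open>i\<close> from
      \<open>j\<close>.\<close>
    define F where "F = {e \<in> E. i \<in> e}"
    have "CARD('a) ^ card F \<le> card N"
    proof (rule card_ge_of_unit_functions[OF fin _ z add smult])
      show "finite F" using finE by (simp add: F_def)
      fix e assume e: "e \<in> F"
      then obtain k where k: "e = {i, k}" "i \<noteq> k" "k \<in> {1..n}" using edgeE[of e i] by (auto simp: F_def)
      obtain a b where a: "a \<in> U1" and b: "b \<in> U2"
        and ab: "\<And>l. l \<in> {1..n} \<Longrightarrow> a $ (l - 1) + b $ (l - 1) = of_bool (l = k)"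
        using split[OF k(3)] by blast
      obtain g1 where g1: "g1 \<in> N" "\<And>e. e \<in> E \<Longrightarrow> g1 e = edge_form u b e" using form[OF u(1) b] by blast
      obtain g2 where g2: "g2 \<in> N" "\<And>e. e \<in> E \<Longrightarrow> g2 e = edge_form a v e" using form[OF a v] by blast
      obtain g3 where g3: "g3 \<in> N" "\<And>e. e \<in> E \<Longrightarrow> g3 e = edge_form u v e" using form[OF u(1) v] by blast
      \<comment> \<open>Dividing by \<open>u_i\<close> and by the orientation sign of
        \<open>e\<close> normalises the value on \<open>e\<close> to 1.\<close>
      define c :: 'a where "c = (if i < k then 1 else - 1) / u $ (i - 1)"
      define g where "g = (\<lambda>e. c * ((g1 e + g2 e) + (- (a $ (i - 1) / u $ (i - 1))) * g3 e))"
      have "g \<in> N" unfolding g_def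
        by (rule smult[OF add[OF add[OF g1(1) g2(1)] smult[OF g3(1)]]])
      moreover have "g e' = of_bool (e' = e)" if e': "e' \<in> F" for e'
      proof -
        have e'E: "e' \<in> E" using e' by (simp add: F_def)
        obtain l where l: "e' = {i, l}" "i \<noteq> l" "l \<in> {1..n}" using edgeE[of e' i] e' by (auto simp: F_def)
        have vi: "v $ (i - 1) = - (u $ (i - 1))"
          using uv[OF i] ij by (simp add: add_eq_0_iff)
        have bi: "b $ (i - 1) = - (a $ (i - 1))"
          using ab[OF i] k by (simp add: add_eq_0_iff)
        have vl: "v $ (l - 1) = of_bool (l = j) - u $ (l - 1)" using uv[OF l(3)] by (simp add: eq_diff_eq add.commute)
        have bl: "b $ (l - 1) = of_bool (l = k) - a $ (l - 1)" using ab[OF l(3)] by (simp add: eq_diff_eq add.commute)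
        have "(g1 e' + g2 e') + (- (a $ (i - 1) / u $ (i - 1))) * g3 e'
              = (if i < l then 1 else - 1) * (u $ (i - 1) * of_bool (l = k))"
          unfolding g1(2)[OF e'E] g2(2)[OF e'E] g3(2)[OF e'E]
          unfolding l(1) edge_form_eq[OF l(2)] vi bi vl bl by (rule identity[OF u(2)])
        then have "g e' = (if i < l then 1 else - 1) * (if i < k then 1 else - 1) * of_bool (l = k)"
          using u(2) by (simp add: g_def c_def)
        also have "\<dots> = of_bool (e' = e)" using k l by (auto simp: doubleton_eq_iff)
        finally show ?thesis .
      qed
      ultimately show "\<exists>g\<in>N. \<forall>e'\<in>F. g e' = of_bool (e' = e)" by blast
    qed
    moreover have "\<not> graph_connected {1..n} (E - F)"
      by (rule not_graph_connectedI[OF i j, of "{i}"]) (use ij in \<open>auto simp: F_def\<close>)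
    moreover have "F \<subseteq> E" by (auto simp: F_def)
    ultimately show ?thesis by blast
  next
    case False
    \<comment> \<open>In this case the component in \<open>U1\<close> of each unit vector
      \<open>e_j\<close> is a multiple of \<open>e_j\<close>. \<open>C\<close> collects the indices
      whose unit vector lies in \<open>U1\<close>; every remaining unit vector is shown to lie in
      \<open>U2\<close>.\<close>
    define C where "C = {i \<in> {1..n}. \<exists>u\<in>U1. u $ (i - 1) \<noteq> 0 \<and> (\<forall>l\<in>{1..n}. l \<noteq> i \<longrightarrow> u $ (l - 1) = 0)}"
    have U1C: "unit_vec n (i - 1) \<in> U1" if "i \<in> C" for i
    proof -
      obtain u where u: "u \<in> U1" "u $ (i - 1) \<noteq> 0" "\<And>l. l \<in> {1..n} \<Longrightarrow> l \<noteq> i \<Longrightarrow> u $ (l - 1) = 0"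
        and i: "i \<in> {1..n}" using \<open>i \<in> C\<close> by (auto simp: C_def)
      have "unit_vec n (i - 1) = (1 / u $ (i - 1)) \<cdot>\<^sub>v u"
      proof (rule eq_vecI)
        fix k assume "k < dim_vec ((1 / u $ (i - 1)) \<cdot>\<^sub>v u)"
        then have k: "k < n" using vec_subspace_dim[OF U1 u(1)] by simp
        then show "unit_vec n (i - 1) $ k = ((1 / u $ (i - 1)) \<cdot>\<^sub>v u) $ k"
          using u(2) u(3)[of "Suc k"] vec_subspace_dim[OF U1 u(1)] i by auto
      qed (use vec_subspace_dim[OF U1 u(1)] in simp)
      then show ?thesis using vec_subspace_smult[OF U1 u(1)] by simp
    qed
    have U2C: "unit_vec n (j - 1) \<in> U2" if j: "j \<in> {1..n}" "j \<notin> C" for j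
    proof -
      obtain u v where uv: "u \<in> U1" "v \<in> U2"
        "\<And>l. l \<in> {1..n} \<Longrightarrow> u $ (l - 1) + v $ (l - 1) = of_bool (l = j)" using split[OF j(1)] by blast
      have ul: "u $ (l - 1) = 0" if "l \<in> {1..n}" "l \<noteq> j" for l
        using False that j(1) uv by blast
      then have "u $ (j - 1) = 0" using j uv(1) by (auto simp: C_def)
      then have u0: "u $ (l - 1) = 0" if "l \<in> {1..n}" for l using ul that by blast
      have "unit_vec n (j - 1) = v"
      proof (rule eq_vecI)
        fix k assume "k < dim_vec v"
        then have k: "k < n" using vec_subspace_dim[OF U2 uv(2)] by simp
        then show "unit_vec n (j - 1) $ k = v $ k"
          using u0[of "Suc k"] uv(3)[of "Suc k"] j(1) by auto
      qed (use vec_subspace_dim[OF U2 uv(2)] in simp)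
      then show ?thesis using uv by simp
    qed
    \<comment> \<open>Were \<open>C\<close> empty, all unit vectors would lie in \<open>U2\<close>;
      were it everything, all would lie in \<open>U1\<close>. Both contradict properness.\<close>
    obtain a where a: "a \<in> {1..n}" "a \<in> C"
      using vec_subspace_eq_carrier[OF U2] U2C ne by blast
    obtain b where b: "b \<in> {1..n}" "b \<notin> C"
      using vec_subspace_eq_carrier[OF U1] U1C ne by blast
    define F where "F = {e \<in> E. e \<inter> C \<noteq> {} \<and> e - C \<noteq> {}}"
    have "CARD('a) ^ card F \<le> card N"
    proof (rule card_ge_of_unit_functions[OF fin _ z add smult])
      show "finite F" using finE by (simp add: F_def)
      fix e assume e: "e \<in> F"
      then obtain i where i: "i \<in> e" "i \<in> C" and eE: "e \<in> E" by (auto simp: F_def)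
      then obtain k where k: "e = {i, k}" "i \<noteq> k" "k \<in> {1..n}" using edgeE by blast
      have kC: "k \<notin> C" using e i k by (auto simp: F_def)
      have i1: "i \<in> {1..n}" using i by (simp add: C_def)
      obtain g1 where g1: "g1 \<in> N" "\<And>e. e \<in> E \<Longrightarrow> g1 e = edge_form (unit_vec n (i - 1)) (unit_vec n (k - 1)) e"
        using form[OF U1C[OF i(2)] U2C[OF k(3) kC]] by blast
      define c :: 'a where "c = (if i < k then 1 else - 1)"
      define g where "g = (\<lambda>e. c * g1 e)"
      have "g \<in> N" unfolding g_def by (rule smult[OF g1(1)])
      moreover have "g e' = of_bool (e' = e)" if e': "e' \<in> F" for e'
      proof -
        obtain r where r: "r \<in> e'" "r \<in> C" and e'E: "e' \<in> E" using e' by (auto simp: F_def)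
        then obtain l where l: "e' = {r, l}" "r \<noteq> l" "l \<in> {1..n}" using edgeE by blast
        have lC: "l \<notin> C" using e' r l by (auto simp: F_def)
        have r1: "r \<in> {1..n}" using r by (simp add: C_def)
        have iu: "unit_vec n (x - 1) $ (y - 1) = (of_bool (x = y) :: 'a)" if "x \<in> {1..n}" "y \<in> {1..n}" for x y
          using that by (auto simp: unit_vec_def)
        \<comment> \<open>Crossing edges are named with the endpoint in \<open>C\<close> first, so
          the reversed matching of endpoints cannot occur and only one term of the minor
          survives.\<close>
        have ne: "l \<noteq> i" "r \<noteq> k" using lC i kC r by auto
        have "g1 e' = (if r < l then 1 else - 1) * (of_bool (i = r) * of_bool (k = l))"
          unfolding g1(2)[OF e'E]
          unfolding l(1) edge_form_eq[OF l(2)] iu[OF i1 r1] iu[OF k(3) l(3)]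
            iu[OF i1 l(3)] iu[OF k(3) r1] using ne by simp
        moreover have "(e' = e) = (i = r \<and> k = l)" unfolding k(1) l(1) doubleton_eq_iff using ne by blast
        ultimately show ?thesis by (simp add: c_def g_def)
      qed
      ultimately show "\<exists>g\<in>N. \<forall>e'\<in>F. g e' = of_bool (e' = e)" by blast
    qed
    moreover have "\<not> graph_connected {1..n} (E - F)"
      by (rule not_graph_connectedI[OF a(1) b(1) a(2) b(2)]) (auto simp: F_def)
    moreover have "F \<subseteq> E" by (auto simp: F_def)
    ultimately show ?thesis by blast
  qed
qed

section \<open>Central decompositions of subgroups and quotients\<close>

lemma (in group) commutator_eq_one_iff:
  assumes "x \<in> carrier G" "y \<in> carrier G"
  shows "x \<otimes> y \<otimes> inv x \<otimes> inv y = \<one> \<longleftrightarrow> x \<otimes> y = y \<otimes> x"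
proof -
  have "x \<otimes> y \<otimes> inv x \<otimes> inv y = (x \<otimes> y) \<otimes> inv (y \<otimes> x)"
    using assms by (simp add: inv_mult_group m_assoc)
  then show ?thesis
    using assms by (metis inv_closed inv_equality inv_inv m_closed r_inv)
qed

lemma (in group) commutator_subgroup_trivial_iff:
  assumes "J \<subseteq> carrier G" "K \<subseteq> carrier G"
  shows "commutator_subgroup G J K = {\<one>} \<longleftrightarrow> (\<forall>j\<in>J. \<forall>k\<in>K. j \<otimes> k = k \<otimes> j)"
proof
  assume *: "commutator_subgroup G J K = {\<one>}"
  show "\<forall>j\<in>J. \<forall>k\<in>K. j \<otimes> k = k \<otimes> j"
  proof (intro ballI)
    fix j k assume jk: "j \<in> J" "k \<in> K"
    then have "j \<otimes> k \<otimes> inv j \<otimes> inv k \<in> commutator_subgroup G J K"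
      unfolding commutator_subgroup_def by (intro generate.incl) blast
    then show "j \<otimes> k = k \<otimes> j"
      using * commutator_eq_one_iff[of j k] jk assms by auto
  qed
next
  assume *: "\<forall>j\<in>J. \<forall>k\<in>K. j \<otimes> k = k \<otimes> j"
  have "commutator_subgroup G J K \<subseteq> {\<one>}"
    unfolding commutator_subgroup_def
  proof (rule generate_subgroup_incl[OF _ triv_subgroup])
    show "{j \<otimes> k \<otimes> inv j \<otimes> inv k | j k. j \<in> J \<and> k \<in> K} \<subseteq> {\<one>}"
      using * commutator_eq_one_iff assms by blast
  qed
  moreover have "\<one> \<in> commutator_subgroup G J K"
    unfolding commutator_subgroup_def by (rule generate.one)
  ultimately show "commutator_subgroup G J K = {\<one>}" by blast
qed

text \<open>Nontriviality of one factor follows from properness of the other, since a trivial factor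
  makes the other the whole group.\<close>

lemma (in group) admits_central_decomposition_iff:
  "admits_central_decomposition G \<longleftrightarrow>
     (\<exists>J K. subgroup J G \<and> J \<noteq> carrier G \<and> subgroup K G \<and> K \<noteq> carrier G \<and>
        (\<forall>j\<in>J. \<forall>k\<in>K. j \<otimes> k = k \<otimes> j) \<and> (\<forall>x\<in>carrier G. \<exists>j\<in>J. \<exists>k\<in>K. x = j \<otimes> k))"
  (is "?L \<longleftrightarrow> ?R")
proof
  assume ?L
  then obtain J K where JK: "subgroup J G" "J \<noteq> carrier G" "subgroup K G" "K \<noteq> carrier G"
    "commutator_subgroup G J K = {\<one>}" "carrier G = J <#> K"
    unfolding admits_central_decomposition_def by blast
  moreover have "\<forall>x\<in>carrier G. \<exists>j\<in>J. \<exists>k\<in>K. x = j \<otimes> k"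
    using JK(6) unfolding set_mult_def by blast
  ultimately show ?R
    using commutator_subgroup_trivial_iff[of J K] subgroup.subset by metis
next
  assume ?R
  then obtain J K where JK: "subgroup J G" "J \<noteq> carrier G" "subgroup K G" "K \<noteq> carrier G"
    and comm: "\<forall>j\<in>J. \<forall>k\<in>K. j \<otimes> k = k \<otimes> j"
    and prod: "\<And>x. x \<in> carrier G \<Longrightarrow> \<exists>j\<in>J. \<exists>k\<in>K. x = j \<otimes> k"
    by blast
  note sub = subgroup.subset[OF JK(1)] subgroup.subset[OF JK(3)]
  have "carrier G = J <#> K"
    using prod sub unfolding set_mult_def by auto
  moreover have "J \<noteq> {\<one>}"
  proof
    assume "J = {\<one>}"
    then have "carrier G \<subseteq> K" using prod sub(2) by fastforce
    with JK(4) sub show False by blast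
  qed
  moreover have "K \<noteq> {\<one>}"
  proof
    assume "K = {\<one>}"
    then have "carrier G \<subseteq> J" using prod sub(1) by fastforce
    with JK(2) sub show False by blast
  qed
  ultimately show ?L
    unfolding admits_central_decomposition_def
    using JK comm commutator_subgroup_trivial_iff[OF sub] by blast
qed

lemma (in group) subgroup_admits_central_decomposition_iff:
  assumes S: "subgroup S G"
  shows "admits_central_decomposition (G\<lparr>carrier := S\<rparr>) \<longleftrightarrow>
     (\<exists>J K. subgroup J G \<and> J \<subset> S \<and> subgroup K G \<and> K \<subset> S \<and>
        (\<forall>j\<in>J. \<forall>k\<in>K. j \<otimes> k = k \<otimes> j) \<and> (\<forall>x\<in>S. \<exists>j\<in>J. \<exists>k\<in>K. x = j \<otimes> k))"
proof -
  interpret S: group "G\<lparr>carrier := S\<rparr>" by (rule subgroup.subgroup_is_group[OF S group_axioms])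
  have proper: "subgroup J (G\<lparr>carrier := S\<rparr>) \<and> J \<noteq> S \<longleftrightarrow> subgroup J G \<and> J \<subset> S" for J
    using incl_subgroup[OF S, of J] subgroup_incl[of J S] S subgroup.subset[of J "G\<lparr>carrier := S\<rparr>"]
    by auto
  have "admits_central_decomposition (G\<lparr>carrier := S\<rparr>) \<longleftrightarrow>
     (\<exists>J K. (subgroup J (G\<lparr>carrier := S\<rparr>) \<and> J \<noteq> S) \<and> (subgroup K (G\<lparr>carrier := S\<rparr>) \<and> K \<noteq> S) \<and>
        (\<forall>j\<in>J. \<forall>k\<in>K. j \<otimes> k = k \<otimes> j) \<and> (\<forall>x\<in>S. \<exists>j\<in>J. \<exists>k\<in>K. x = j \<otimes> k))"
    unfolding S.admits_central_decomposition_iff by (simp add: conj_assoc)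
  then show ?thesis unfolding proper by (simp only: conj_assoc)
qed

text \<open>The correspondence theorem: subgroups of the quotient become subgroups of
  \<open>G\<close> containing \<open>H\<close>, and commuting cosets become commutators in
  \<open>H\<close>.\<close>

lemma (in normal) factor_admits_central_decomposition_iff:
  "admits_central_decomposition (G Mod H) \<longleftrightarrow>
     (\<exists>J K. subgroup J G \<and> H \<subseteq> J \<and> J \<noteq> carrier G \<and> subgroup K G \<and> H \<subseteq> K \<and> K \<noteq> carrier G \<and>
        (\<forall>j\<in>J. \<forall>k\<in>K. j \<otimes> k \<otimes> inv j \<otimes> inv k \<in> H) \<and> (\<forall>x\<in>carrier G. \<exists>j\<in>J. \<exists>k\<in>K. x = j \<otimes> k))"
  (is "?L \<longleftrightarrow> ?R")
proof -
  interpret M: group "G Mod H" by (rule factorgroup_is_group)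
  interpret h: group_hom G "G Mod H" "\<lambda>x. H #> x"
    by (rule group_hom.intro[OF is_group M.is_group]) (simp add: group_hom_axioms_def r_coset_hom_Mod)
  have carr: "carrier (G Mod H) = (\<lambda>x. H #> x) ` carrier G" by (rule carrier_FactGroup)
  have eq_iff: "H #> x = H #> y \<longleftrightarrow> (\<exists>n\<in>H. x = n \<otimes> y)" if "x \<in> carrier G" "y \<in> carrier G" for x y
  proof
    assume "H #> x = H #> y"
    then have "x \<in> H #> y" using rcos_self[OF that(1) subgroup_axioms] by simp
    then show "\<exists>n\<in>H. x = n \<otimes> y" unfolding r_coset_def by blast
  next
    assume "\<exists>n\<in>H. x = n \<otimes> y"
    then have "x \<in> H #> y" unfolding r_coset_def by blast
    then show "H #> x = H #> y" using repr_independence[OF _ that(2) subgroup_axioms] by simp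
  qed
  have comm: "H #> (x \<otimes> y) = H #> (y \<otimes> x) \<longleftrightarrow> x \<otimes> y \<otimes> inv x \<otimes> inv y \<in> H"
    if xy: "x \<in> carrier G" "y \<in> carrier G" for x y
  proof -
    have "x \<otimes> y \<otimes> inv x \<otimes> inv y = (x \<otimes> y) \<otimes> inv (y \<otimes> x)"
      using xy by (simp add: inv_mult_group m_assoc)
    moreover have "x \<otimes> y = n \<otimes> (y \<otimes> x) \<longleftrightarrow> n = (x \<otimes> y) \<otimes> inv (y \<otimes> x)" if "n \<in> H" for n
      using xy mem_carrier[OF that] by (metis inv_solve_right m_closed)
    ultimately show ?thesis using eq_iff[of "x \<otimes> y" "y \<otimes> x"] xy by (metis m_closed)
  qed
  show ?thesis
  proof
    assume ?L
    then obtain J K where JK: "subgroup J (G Mod H)" "J \<noteq> carrier (G Mod H)"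
        "subgroup K (G Mod H)" "K \<noteq> carrier (G Mod H)"
      and comm': "\<forall>j\<in>J. \<forall>k\<in>K. j <#> k = k <#> j"
      and prod': "\<forall>x\<in>carrier (G Mod H). \<exists>j\<in>J. \<exists>k\<in>K. x = j <#> k"
      unfolding M.admits_central_decomposition_iff mult_FactGroup by blast
    note JKc = comm'[rule_format] and JKp = prod'[rule_format]
    define pre where "pre A = {x \<in> carrier G. H #> x \<in> A}" for A
    have pre_sub: "subgroup (pre A) G \<and> H \<subseteq> pre A \<and> pre A \<noteq> carrier G"
      if A: "subgroup A (G Mod H)" "A \<noteq> carrier (G Mod H)" for A
    proof (intro conjI)
      have 1: "H \<in> A" using subgroup.one_closed[OF A(1)] by simp
      show "H \<subseteq> pre A"
      proof
        fix x assume x: "x \<in> H"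
        then have "H #> x = H" by (rule rcos_const[OF is_group])
        with 1 x show "x \<in> pre A" by (simp add: pre_def)
      qed
      show "subgroup (pre A) G"
      proof (rule subgroupI)
        show "pre A \<noteq> {}"
          using subsetD[OF \<open>H \<subseteq> pre A\<close> subgroup.one_closed[OF subgroup_axioms]] by blast
        show "inv a \<in> pre A" if a: "a \<in> pre A" for a
        proof -
          have a: "a \<in> carrier G" "H #> a \<in> A" using a by (simp_all add: pre_def)
          have "H #> inv a \<in> A"
            unfolding h.hom_inv[OF a(1)] by (rule subgroup.m_inv_closed[OF A(1) a(2)])
          then show ?thesis using a by (simp add: pre_def)
        qed
        show "a \<otimes> b \<in> pre A" if a: "a \<in> pre A" and b: "b \<in> pre A" for a b
        proof -
          have ab: "a \<in> carrier G" "H #> a \<in> A" "b \<in> carrier G" "H #> b \<in> A"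
            using a b by (simp_all add: pre_def)
          have "H #> (a \<otimes> b) \<in> A"
            unfolding h.hom_mult[OF ab(1,3)] by (rule subgroup.m_closed[OF A(1) ab(2,4)])
          then show ?thesis using ab by (simp add: pre_def)
        qed
      qed (auto simp: pre_def)
      show "pre A \<noteq> carrier G"
      proof
        assume "pre A = carrier G"
        then have "carrier (G Mod H) \<subseteq> A" unfolding carr by (auto simp: pre_def)
        then show False using A(2) subgroup.subset[OF A(1)] by blast
      qed
    qed
    have "j \<otimes> k \<otimes> inv j \<otimes> inv k \<in> H" if "j \<in> pre J" "k \<in> pre K" for j k
    proof -
      have jk: "j \<in> carrier G" "k \<in> carrier G" "H #> j \<in> J" "H #> k \<in> K" using that by (auto simp: pre_def)
      then have "H #> (j \<otimes> k) = H #> (k \<otimes> j)"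
        using JKc[OF jk(3,4)] unfolding rcos_sum[OF jk(1,2)] rcos_sum[OF jk(2,1)] by blast
      then show ?thesis unfolding comm[OF jk(1,2)] .
    qed
    moreover have "\<exists>j\<in>pre J. \<exists>k\<in>pre K. x = j \<otimes> k" if x: "x \<in> carrier G" for x
    proof -
      have "H #> x \<in> carrier (G Mod H)" using x carr by blast
      from JKp[OF this] obtain j' k' where jk': "j' \<in> J" "k' \<in> K" "H #> x = j' <#> k'" by blast
      have "j' \<in> carrier (G Mod H)" "k' \<in> carrier (G Mod H)"
        using jk' subgroup.subset[OF JK(1)] subgroup.subset[OF JK(3)] by auto
      then obtain j k where jk: "j' = H #> j" "k' = H #> k" "j \<in> carrier G" "k \<in> carrier G"
        unfolding carr by blast
      have "H #> x = H #> (j \<otimes> k)"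
        unfolding jk'(3) jk(1,2) by (rule rcos_sum[OF jk(3,4)])
      \<comment> \<open>The product of representatives agrees with \<open>x\<close> up to a factor
        from \<open>H\<close>, which is absorbed into the first factor because preimages are unions
        of cosets of \<open>H\<close>.\<close>
      then obtain n where n: "n \<in> H" "x = n \<otimes> (j \<otimes> k)"
        using eq_iff[OF x m_closed[OF jk(3,4)]] by blast
      have nc: "n \<in> carrier G" by (rule mem_carrier[OF n(1)])
      have "H #> (n \<otimes> j) = H #> j" using eq_iff[OF m_closed[OF nc jk(3)] jk(3)] n(1) by blast
      then have "H #> (n \<otimes> j) \<in> J" using jk'(1) jk(1) by (simp only:)
      then have "n \<otimes> j \<in> pre J" unfolding pre_def using m_closed[OF nc jk(3)] by blast
      moreover have "k \<in> pre K" unfolding pre_def using jk'(2) jk(2,4) by blast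
      moreover have "x = (n \<otimes> j) \<otimes> k" unfolding n(2) by (rule m_assoc[OF nc jk(3,4), symmetric])
      ultimately show ?thesis by blast
    qed
    ultimately have "(\<forall>j\<in>pre J. \<forall>k\<in>pre K. j \<otimes> k \<otimes> inv j \<otimes> inv k \<in> H) \<and>
        (\<forall>x\<in>carrier G. \<exists>j\<in>pre J. \<exists>k\<in>pre K. x = j \<otimes> k)"
      by simp
    with pre_sub[OF JK(1,2)] pre_sub[OF JK(3,4)] show ?R
      by (intro exI[of _ "pre J"] exI[of _ "pre K"] conjI) simp_all
  next
    assume ?R
    then obtain J K where J: "subgroup J G" "H \<subseteq> J" "J \<noteq> carrier G"
      and K: "subgroup K G" "H \<subseteq> K" "K \<noteq> carrier G"
      and comm': "\<forall>j\<in>J. \<forall>k\<in>K. j \<otimes> k \<otimes> inv j \<otimes> inv k \<in> H"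
      and prod': "\<forall>x\<in>carrier G. \<exists>j\<in>J. \<exists>k\<in>K. x = j \<otimes> k"
      by blast
    note JKc = comm'[rule_format] and JKp = prod'[rule_format]
    have img: "subgroup ((\<lambda>x. H #> x) ` A) (G Mod H) \<and> (\<lambda>x. H #> x) ` A \<noteq> carrier (G Mod H)"
      if A: "subgroup A G" "H \<subseteq> A" "A \<noteq> carrier G" for A
    proof
      show "subgroup ((\<lambda>x. H #> x) ` A) (G Mod H)" by (rule h.subgroup_img_is_subgroup[OF A(1)])
      obtain x where x: "x \<in> carrier G" "x \<notin> A" using A subgroup.subset[OF A(1)] by blast
      have "H #> x \<notin> (\<lambda>x. H #> x) ` A"
      proof
        assume "H #> x \<in> (\<lambda>x. H #> x) ` A"
        then obtain a where a: "a \<in> A" "H #> x = H #> a" by blast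
        then have "a \<in> carrier G" using subgroup.subset[OF A(1)] by blast
        then obtain n where "n \<in> H" "x = n \<otimes> a" using eq_iff x a by blast
        then show False using x subgroup.m_closed[OF A(1)] A(2) a by blast
      qed
      then show "(\<lambda>x. H #> x) ` A \<noteq> carrier (G Mod H)" using x carr by blast
    qed
    note sub = subgroup.subset[OF J(1)] subgroup.subset[OF K(1)]
    have img_comm: "(H #> j) <#> (H #> k) = (H #> k) <#> (H #> j)" if "j \<in> J" "k \<in> K" for j k
    proof -
      have jk: "j \<in> carrier G" "k \<in> carrier G" using that sub by auto
      show ?thesis
        unfolding rcos_sum[OF jk] rcos_sum[OF jk(2,1)] comm[OF jk] by (rule JKc[OF that])
    qed
    have img_prod: "\<exists>j\<in>(\<lambda>x. H #> x) ` J. \<exists>k\<in>(\<lambda>x. H #> x) ` K. X = j <#> k"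
      if X: "X \<in> carrier (G Mod H)" for X
    proof -
      obtain x where x: "x \<in> carrier G" "X = H #> x" using X carr by blast
      obtain j k where jk: "j \<in> J" "k \<in> K" "x = j \<otimes> k" using JKp[OF x(1)] by blast
      then have jkc: "j \<in> carrier G" "k \<in> carrier G" using sub by auto
      have "X = (H #> j) <#> (H #> k)" unfolding x(2) jk(3) by (rule rcos_sum[OF jkc, symmetric])
      then show ?thesis using jk by blast
    qed
    have "\<forall>j\<in>(\<lambda>x. H #> x) ` J. \<forall>k\<in>(\<lambda>x. H #> x) ` K. j <#> k = k <#> j"
    proof (intro ballI)
      fix a b assume "a \<in> (\<lambda>x. H #> x) ` J" "b \<in> (\<lambda>x. H #> x) ` K"
      then obtain j k where jk: "a = H #> j" "j \<in> J" "b = H #> k" "k \<in> K" by blast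
      show "a <#> b = b <#> a" unfolding jk(1,3) by (rule img_comm[OF jk(2,4)])
    qed
    moreover have "\<forall>x\<in>carrier (G Mod H). \<exists>j\<in>(\<lambda>x. H #> x) ` J. \<exists>k\<in>(\<lambda>x. H #> x) ` K. x = j <#> k"
      using img_prod by (rule ballI)
    ultimately show ?L unfolding M.admits_central_decomposition_iff mult_FactGroup
      using img[OF J] img[OF K]
      by (intro exI[of _ "(\<lambda>x. H #> x) ` J"] exI[of _ "(\<lambda>x. H #> x) ` K"] conjI) (elim conjE, assumption)+
  qed
qed

section \<open>The Baer group of a tuple of alternating matrices\<close>

text \<open>Both maps induce the same partition of \<open>S\<close>; the bijection picks a
  representative of a fibre of \<open>f\<close> and applies \<open>g\<close>. This serves to count
  cosets by first components.\<close>

lemma card_image_eq_of_same_fibres: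
  assumes "\<And>x y. x \<in> S \<Longrightarrow> y \<in> S \<Longrightarrow> f x = f y \<longleftrightarrow> g x = g y"
  shows "card (f ` S) = card (g ` S)"
proof -
  have *: "g (inv_into S f (f x)) = g x" if "x \<in> S" for x
    using assms[OF inv_into_into[OF imageI[OF that, of f]] that] f_inv_into_f[OF imageI[OF that, of f]] by simp
  have "bij_betw (\<lambda>z. g (inv_into S f z)) (f ` S) (g ` S)"
  proof (rule bij_betw_imageI)
    show "inj_on (\<lambda>z. g (inv_into S f z)) (f ` S)"
    proof (rule inj_onI)
      fix z w assume "z \<in> f ` S" "w \<in> f ` S" and eq: "g (inv_into S f z) = g (inv_into S f w)"
      then obtain x y where xy: "x \<in> S" "y \<in> S" "z = f x" "w = f y" by blast
      then have "g x = g y" using eq * by simp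
      then show "z = w" using assms xy by blast
    qed
    show "(\<lambda>z. g (inv_into S f z)) ` (f ` S) = g ` S"
      unfolding image_image using * by (rule image_cong[OF refl])
  qed
  then show ?thesis by (rule bij_betw_same_card)
qed

text \<open>Every scalar of the prime field is a natural number multiple of 1, so additive closure
  gives closure under scalars. This is how subgroups of \<open>P\<close> yield subspaces.\<close>

lemma vec_subspace_mod_ringI:
  fixes U :: "'p::prime_card mod_ring vec set"
  assumes "U \<subseteq> carrier_vec n" "0\<^sub>v n \<in> U" "\<And>u v. u \<in> U \<Longrightarrow> v \<in> U \<Longrightarrow> u + v \<in> U"
  shows "vec_subspace n U"
  unfolding vec_subspace_def
proof (intro conjI allI ballI)
  fix c :: "'p mod_ring" and u assume u: "u \<in> U"
  have "of_nat k \<cdot>\<^sub>v u \<in> U" for k :: nat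
  proof (induction k)
    case 0
    have "dim_vec u = n" using u assms(1) by auto
    then have "(of_nat 0 :: 'p mod_ring) \<cdot>\<^sub>v u = 0\<^sub>v n" by auto
    then show ?case using assms(2) by metis
  next
    case (Suc k)
    have "of_nat (Suc k) \<cdot>\<^sub>v u = u + of_nat k \<cdot>\<^sub>v u" by (simp add: add_smult_distrib_vec)
    then show ?case using assms(3)[OF u Suc] by metis
  qed
  then show "c \<cdot>\<^sub>v u \<in> U" using surj_of_nat_mod_ring[of c] by metis
qed (use assms in auto)

section \<open>Coordinate subspaces and their cardinality\<close>

definition coord_subspace :: "nat \<Rightarrow> nat set \<Rightarrow> 'a::field vec set" where
  "coord_subspace n C = {v \<in> carrier_vec n. \<forall>i\<in>{1..n} - C. v $ (i - 1) = 0}"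

lemma coord_subspaceI:
  assumes "dim_vec v = n" "\<And>i. i \<in> {1..n} \<Longrightarrow> i \<notin> C \<Longrightarrow> v $ (i - 1) = 0"
  shows "v \<in> coord_subspace n C"
  unfolding coord_subspace_def using carrier_vecI[OF assms(1)] assms(2) by blast

lemma coord_subspaceD:
  assumes "v \<in> coord_subspace n C"
  shows "dim_vec v = n" "\<And>i. i \<in> {1..n} \<Longrightarrow> i \<notin> C \<Longrightarrow> v $ (i - 1) = 0"
  using assms unfolding coord_subspace_def by auto

lemma vec_subspace_coord: "vec_subspace n (coord_subspace n C)"
  unfolding vec_subspace_def
proof (intro conjI ballI allI)
  fix u v :: "'a vec" and c :: 'a
  assume u: "u \<in> coord_subspace n C"
  show "c \<cdot>\<^sub>v u \<in> coord_subspace n C"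
  proof (rule coord_subspaceI)
    fix i assume i: "i \<in> {1..n}" "i \<notin> C"
    then have "i - 1 < n" by auto
    then show "(c \<cdot>\<^sub>v u) $ (i - 1) = 0" using coord_subspaceD(2)[OF u i] coord_subspaceD(1)[OF u] by simp
  qed (use coord_subspaceD(1)[OF u] in simp)
  assume v: "v \<in> coord_subspace n C"
  show "u + v \<in> coord_subspace n C"
  proof (rule coord_subspaceI)
    fix i assume i: "i \<in> {1..n}" "i \<notin> C"
    then have "i - 1 < n" by auto
    then show "(u + v) $ (i - 1) = 0"
      using coord_subspaceD(2)[OF u i] coord_subspaceD(2)[OF v i] coord_subspaceD(1)[OF v] by simp
  qed (use coord_subspaceD(1)[OF v] in simp)
qed (auto simp: coord_subspace_def)

lemma coord_subspace_full: "coord_subspace n {1..n} = carrier_vec n"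
  unfolding coord_subspace_def by simp

lemma card_coord_subspace:
  assumes "C \<subseteq> {1..n}"
  shows "card (coord_subspace n C :: 'a::{field,finite} vec set) = CARD('a) ^ card C"
proof -
  have fC: "finite C" using assms finite_subset by blast
  have "bij_betw (\<lambda>v. restrict (\<lambda>i. v $ (i - 1)) C) (coord_subspace n C) (C \<rightarrow>\<^sub>E (UNIV :: 'a set))"
  proof (rule bij_betwI[where g = "\<lambda>f. vec n (\<lambda>k. if Suc k \<in> C then f (Suc k) else 0)"])
    show "(\<lambda>f. vec n (\<lambda>k. if Suc k \<in> C then f (Suc k) else 0)) \<in> (C \<rightarrow>\<^sub>E UNIV) \<rightarrow> coord_subspace n C"
      by (auto simp: coord_subspace_def)
    show "vec n (\<lambda>k. if Suc k \<in> C then restrict (\<lambda>i. v $ (i - 1)) C (Suc k) else 0) = v"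
      if v: "v \<in> coord_subspace n C" for v :: "'a vec"
    proof (rule eq_vecI)
      have d: "dim_vec v = n" by (rule coord_subspaceD(1)[OF v])
      fix k assume "k < dim_vec v"
      then have "k < n" "Suc k \<in> {1..n}" using d by auto
      moreover have "v $ k = 0" if "Suc k \<notin> C"
        using coord_subspaceD(2)[OF v \<open>Suc k \<in> {1..n}\<close> that] by simp
      ultimately show "vec n (\<lambda>k. if Suc k \<in> C then restrict (\<lambda>i. v $ (i - 1)) C (Suc k) else 0) $ k = v $ k"
        by auto
    qed (use coord_subspaceD(1)[OF v] in simp)
    show "restrict (\<lambda>i. vec n (\<lambda>k. if Suc k \<in> C then f (Suc k) else 0) $ (i - 1)) C = f"
      if f: "f \<in> C \<rightarrow>\<^sub>E (UNIV :: 'a set)" for f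
    proof
      fix i
      show "restrict (\<lambda>i. vec n (\<lambda>k. if Suc k \<in> C then f (Suc k) else 0) $ (i - 1)) C i = f i"
      proof (cases "i \<in> C")
        case True
        then have "i \<in> {1..n}" using assms by blast
        then show ?thesis using True by auto
      qed (use PiE_arb[OF f] in simp)
    qed
  qed auto
  then have "card (coord_subspace n C :: 'a vec set) = card (C \<rightarrow>\<^sub>E (UNIV :: 'a set))"
    by (rule bij_betw_same_card)
  then show ?thesis using fC by (simp add: card_PiE)
qed

lemma card_carrier_vec: "card (carrier_vec n :: 'a::{field,finite} vec set) = CARD('a) ^ n"
  using card_coord_subspace[of "{1..n}" n, where 'a='a] unfolding coord_subspace_full by simp

lemma finite_carrier_vec: "finite (carrier_vec n :: 'a::{field,finite} vec set)"
  by (rule card_ge_0_finite) (simp add: card_carrier_vec)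

text \<open>Entries indexed by \<open>A\<close> go to the first summand and all others to the
  second, so \<open>A\<close> and \<open>B\<close> may overlap.\<close>

lemma coord_subspace_sum:
  fixes w :: "'a::field vec"
  assumes "w \<in> coord_subspace n C" "C = A \<union> B"
  shows "\<exists>u\<in>coord_subspace n A. \<exists>v\<in>coord_subspace n B. w = u + v"
proof -
  define u where "u = vec n (\<lambda>k. if Suc k \<in> A then w $ k else 0)"
  define v where "v = vec n (\<lambda>k. if Suc k \<in> A then 0 else w $ k)"
  have d: "dim_vec w = n" by (rule coord_subspaceD(1)[OF assms(1)])
  have "w = u + v" using d by (auto simp: u_def v_def)
  moreover have "u \<in> coord_subspace n A"
    by (rule coord_subspaceI) (auto simp: u_def)
  moreover have "v \<in> coord_subspace n B"
  proof (rule coord_subspaceI)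
    fix i assume i: "i \<in> {1..n}" "i \<notin> B"
    show "v $ (i - 1) = 0"
    proof (cases "i \<in> A")
      case False
      then have "w $ (i - 1) = 0" using coord_subspaceD(2)[OF assms(1) i(1)] i assms(2) by blast
      then show ?thesis using i by (auto simp: v_def)
    qed (use i in \<open>auto simp: v_def\<close>)
  qed (simp add: v_def)
  ultimately show ?thesis by blast
qed

lemma unit_vec_coord_subspace_iff:
  assumes "i \<in> {1..n}"
  shows "(unit_vec n (i - 1) :: 'a::field vec) \<in> coord_subspace n C \<longleftrightarrow> i \<in> C"
proof
  assume *: "(unit_vec n (i - 1) :: 'a vec) \<in> coord_subspace n C"
  have "(unit_vec n (i - 1) :: 'a vec) $ (i - 1) = 1" using assms by auto
  then show "i \<in> C" using coord_subspaceD(2)[OF * assms] by auto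
next
  assume C: "i \<in> C"
  show "(unit_vec n (i - 1) :: 'a vec) \<in> coord_subspace n C"
  proof (rule coord_subspaceI)
    fix j assume j: "j \<in> {1..n}" "j \<notin> C"
    then have "j \<noteq> i" using C by blast
    then have "j - 1 \<noteq> i - 1" "j - 1 < n" "i - 1 < n" using assms j by auto
    then show "(unit_vec n (i - 1) :: 'a vec) $ (j - 1) = 0" by simp
  qed simp
qed

lemma (in group) r_coset_eq_iff:
  assumes "subgroup D G" "x \<in> carrier G" "y \<in> carrier G"
  shows "D #> x = D #> y \<longleftrightarrow> x \<otimes> inv y \<in> D"
proof -
  interpret subgroup D G by fact
  have "x \<in> D #> y \<longleftrightarrow> x \<otimes> inv y \<in> D" using rcos_module[OF is_group] assms by blast
  moreover have "x \<in> D #> y \<longleftrightarrow> D #> x = D #> y"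
    using rcos_self[OF assms(2,1)] repr_independence[OF _ assms(3,1)] by auto
  ultimately show ?thesis by simp
qed

lemma (in group) central_subgroup_normal:
  assumes "subgroup N G" "N \<subseteq> group_center G"
  shows "N \<lhd> G"
proof (rule normal_invI[OF assms(1)])
  fix x h assume x: "x \<in> carrier G" and h: "h \<in> N"
  then have "h \<in> carrier G" "h \<otimes> x = x \<otimes> h"
    using assms(2) by (auto simp: group_center_def)
  then have "x \<otimes> h \<otimes> inv x = h" using x by (metis inv_closed m_assoc r_inv r_one)
  then show "x \<otimes> h \<otimes> inv x \<in> N" using h by simp
qed

section \<open>The alternating bilinear map and the group law\<close>

lemma alternating_form_carrier [simp]: "alternating_form As v u \<in> carrier_vec (length As)"
  and alternating_form_dim [simp]: "dim_vec (alternating_form As v u) = length As"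
  by (simp_all add: alternating_form_def)

text \<open>The alternating property is stated as vanishing of the quadratic form, which is how it
  enters the group law. Skew symmetry is derived from it by polarization.\<close>

locale alternating_matrices =
  fixes n :: nat and As :: "'p::prime_card mod_ring mat list"
  assumes square: "A \<in> set As \<Longrightarrow> A \<in> carrier_mat n n"
    and alternating: "A \<in> set As \<Longrightarrow> v \<in> carrier_vec n \<Longrightarrow> v \<bullet> (A *\<^sub>v v) = 0"
    and odd_char: "odd CARD('p)"
begin

abbreviation "m \<equiv> length As"
abbreviation "\<phi> \<equiv> alternating_form As"
abbreviation "P \<equiv> baer_group n As"

lemma two_neq_zero: "(2 :: 'p mod_ring) \<noteq> 0"
proof
  assume "(2 :: 'p mod_ring) = 0"
  then have "CARD('p) dvd 2" using of_nat_0_mod_ring_dvd[of 2] by simp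
  then have "CARD('p) \<le> 2" by (rule dvd_imp_le) simp
  moreover have "CARD('p) > 1" using prime_card prime_gt_1_nat by blast
  ultimately show False using odd_char by (metis One_nat_def le_antisym less_eq_Suc_le even_numeral numeral_2_eq_2 dvd_refl)
qed

lemma half_add_half: "1 / 2 * x + 1 / 2 * x = (x :: 'p mod_ring)"
proof -
  have "1 / 2 * x + 1 / 2 * x = (1 / 2 * 2) * x" by (simp only: distrib_left distrib_right mult_2 mult.assoc mult_2_right)
  then show ?thesis using two_neq_zero by simp
qed

lemma form_add_left:
  assumes "v \<in> carrier_vec n" "w \<in> carrier_vec n" "u \<in> carrier_vec n"
  shows "\<phi> (v + w) u = \<phi> v u + \<phi> w u"
proof (rule eq_vecI)
  fix k assume "k < dim_vec (\<phi> v u + \<phi> w u)"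
  then have k: "k < m" by (simp add: alternating_form_def)
  then have "As ! k *\<^sub>v u \<in> carrier_vec n" using square[of "As ! k"] assms by auto
  then show "\<phi> (v + w) u $ k = (\<phi> v u + \<phi> w u) $ k"
    using k assms by (simp add: alternating_form_def add_scalar_prod_distrib)
qed (simp add: alternating_form_def)

lemma form_add_right:
  assumes "v \<in> carrier_vec n" "w \<in> carrier_vec n" "u \<in> carrier_vec n"
  shows "\<phi> u (v + w) = \<phi> u v + \<phi> u w"
proof (rule eq_vecI)
  fix k assume "k < dim_vec (\<phi> u v + \<phi> u w)"
  then have k: "k < m" by (simp add: alternating_form_def)
  then have A: "As ! k \<in> carrier_mat n n" using square[of "As ! k"] by auto
  then have "As ! k *\<^sub>v v \<in> carrier_vec n" "As ! k *\<^sub>v w \<in> carrier_vec n"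
    using assms by auto
  then show "\<phi> u (v + w) $ k = (\<phi> u v + \<phi> u w) $ k"
    using k assms A by (simp add: alternating_form_def scalar_prod_add_distrib mult_add_distrib_mat_vec)
qed (simp add: alternating_form_def)

lemma form_smult_left:
  assumes "v \<in> carrier_vec n" "u \<in> carrier_vec n"
  shows "\<phi> (c \<cdot>\<^sub>v v) u = c \<cdot>\<^sub>v \<phi> v u"
proof (rule eq_vecI)
  fix k assume "k < dim_vec (c \<cdot>\<^sub>v \<phi> v u)"
  then have k: "k < m" by (simp add: alternating_form_def)
  then have "As ! k *\<^sub>v u \<in> carrier_vec n" using square[of "As ! k"] assms by auto
  then show "\<phi> (c \<cdot>\<^sub>v v) u $ k = (c \<cdot>\<^sub>v \<phi> v u) $ k"
    using k assms by (simp add: alternating_form_def)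
qed (simp add: alternating_form_def)

lemma form_self:
  assumes "v \<in> carrier_vec n"
  shows "\<phi> v v = 0\<^sub>v m"
  using assms by (auto simp: alternating_form_def alternating)

lemma form_swap:
  assumes v: "v \<in> carrier_vec n" and u: "u \<in> carrier_vec n"
  shows "\<phi> u v = - \<phi> v u"
proof -
  have "0\<^sub>v m = \<phi> (v + u) (v + u)" using form_self[of "v + u"] v u by simp
  also have "\<dots> = (\<phi> v v + \<phi> u v) + (\<phi> v u + \<phi> u u)"
    using v u by (simp add: form_add_left form_add_right)
  finally have eq: "0\<^sub>v m = (0\<^sub>v m + \<phi> u v) + (\<phi> v u + 0\<^sub>v m)"
    unfolding form_self[OF v] form_self[OF u] .
  show ?thesis
  proof (rule eq_vecI)
    fix k assume "k < dim_vec (- \<phi> v u)"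
    then have k: "k < m" by simp
    have "0\<^sub>v m $ k = ((0\<^sub>v m + \<phi> u v) + (\<phi> v u + 0\<^sub>v m)) $ k" by (simp only: eq[symmetric])
    then show "\<phi> u v $ k = (- \<phi> v u) $ k" using k by (simp add: eq_neg_iff_add_eq_0 add.commute)
  qed simp
qed

lemma form_uminus_left:
  assumes "v \<in> carrier_vec n" "u \<in> carrier_vec n"
  shows "\<phi> (- v) u = - \<phi> v u"
proof -
  have "- v = (- 1) \<cdot>\<^sub>v v" by auto
  then show ?thesis using form_smult_left[OF assms, of "- 1"] by auto
qed

lemma form_uminus_right:
  assumes "v \<in> carrier_vec n" "u \<in> carrier_vec n"
  shows "\<phi> v (- u) = - \<phi> v u"
  using assms form_swap[of u v] form_swap[of "- u" v] by (simp add: form_uminus_left)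

lemma form_zero_left [simp]: "u \<in> carrier_vec n \<Longrightarrow> \<phi> (0\<^sub>v n) u = 0\<^sub>v m"
proof -
  assume u: "u \<in> carrier_vec n"
  then have "0 \<cdot>\<^sub>v u = 0\<^sub>v n" by auto
  moreover have "0 \<cdot>\<^sub>v \<phi> u u = 0\<^sub>v m" by auto
  ultimately show ?thesis using form_smult_left[OF u u, of 0] by simp
qed

lemma form_zero_right [simp]: "u \<in> carrier_vec n \<Longrightarrow> \<phi> u (0\<^sub>v n) = 0\<^sub>v m"
  using form_swap[of "0\<^sub>v n" u] by auto

lemma carrier_P: "carrier P = carrier_vec n \<times> carrier_vec m"
  and one_P: "\<one>\<^bsub>P\<^esub> = (0\<^sub>v n, 0\<^sub>v m)"
  and mult_P: "(v1, u1) \<otimes>\<^bsub>P\<^esub> (v2, u2) = (v1 + v2, u1 + u2 + (1 / 2) \<cdot>\<^sub>v \<phi> v1 v2)"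
  by (simp_all add: baer_group_def)

lemma fst_mult_P: "fst (x \<otimes>\<^bsub>P\<^esub> y) = fst x + fst y"
  by (cases x; cases y) (simp add: mult_P)

text \<open>Associativity is bilinearity of \<open>\<phi>\<close>: both bracketings contribute half
  the sum of the three pairwise values. Since \<open>\<phi>\<close> vanishes on the diagonal,
  inverses are plain negatives.\<close>

sublocale P: group P
proof (rule groupI)
  fix x y z assume x: "x \<in> carrier P" and y: "y \<in> carrier P" and z: "z \<in> carrier P"
  show "x \<otimes>\<^bsub>P\<^esub> y \<in> carrier P" using x y by (auto simp: carrier_P mult_P)
  obtain v1 u1 v2 u2 v3 u3 where eq: "x = (v1, u1)" "y = (v2, u2)" "z = (v3, u3)" by (metis surj_pair)
  then have c: "v1 \<in> carrier_vec n" "v2 \<in> carrier_vec n" "v3 \<in> carrier_vec n"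
    "u1 \<in> carrier_vec m" "u2 \<in> carrier_vec m" "u3 \<in> carrier_vec m"
    using x y z by (auto simp: carrier_P)
  have "u1 + u2 + (1 / 2) \<cdot>\<^sub>v \<phi> v1 v2 + u3 + (1 / 2) \<cdot>\<^sub>v \<phi> (v1 + v2) v3 =
        u1 + (u2 + u3 + (1 / 2) \<cdot>\<^sub>v \<phi> v2 v3) + (1 / 2) \<cdot>\<^sub>v \<phi> v1 (v2 + v3)"
    using c by (intro eq_vecI) (simp_all add: form_add_left form_add_right algebra_simps del: times_divide_eq_left)
  then show "x \<otimes>\<^bsub>P\<^esub> y \<otimes>\<^bsub>P\<^esub> z = x \<otimes>\<^bsub>P\<^esub> (y \<otimes>\<^bsub>P\<^esub> z)"
    using c by (simp add: eq mult_P assoc_add_vec[of _ n])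
  show "\<one>\<^bsub>P\<^esub> \<otimes>\<^bsub>P\<^esub> x = x" using c by (auto simp: eq one_P mult_P)
  show "\<exists>y\<in>carrier P. y \<otimes>\<^bsub>P\<^esub> x = \<one>\<^bsub>P\<^esub>"
  proof (rule bexI)
    show "(- v1, - u1) \<otimes>\<^bsub>P\<^esub> x = \<one>\<^bsub>P\<^esub>"
      using c by (auto simp: eq one_P mult_P form_uminus_left form_self)
    show "(- v1, - u1) \<in> carrier P" using c by (simp add: carrier_P)
  qed
qed (simp add: carrier_P one_P)

lemma inv_P:
  assumes "v \<in> carrier_vec n" "u \<in> carrier_vec m"
  shows "inv\<^bsub>P\<^esub> (v, u) = (- v, - u)"
  by (rule P.inv_equality)
    (use assms in \<open>auto simp: one_P mult_P carrier_P form_uminus_left form_self\<close>)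

text \<open>The terms \<open>1/2 \<phi> a b\<close> and \<open>- 1/2 \<phi> b a\<close> combine by
  skew symmetry to the full value \<open>\<phi> a b\<close>, which is what the factor
  \<open>1/2\<close> in the product achieves.\<close>

lemma commutator_P:
  assumes "x \<in> carrier P" "y \<in> carrier P"
  shows "x \<otimes>\<^bsub>P\<^esub> y \<otimes>\<^bsub>P\<^esub> inv\<^bsub>P\<^esub> x \<otimes>\<^bsub>P\<^esub> inv\<^bsub>P\<^esub> y = (0\<^sub>v n, \<phi> (fst x) (fst y))"
proof -
  obtain a r b s where eq: "x = (a, r)" "y = (b, s)" by (metis surj_pair)
  then have c: "a \<in> carrier_vec n" "b \<in> carrier_vec n" "r \<in> carrier_vec m" "s \<in> carrier_vec m"
    using assms by (auto simp: carrier_P)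
  have "a + b + - a = b" using c by (intro eq_vecI) auto
  moreover have "b + - b = 0\<^sub>v n" using c by (intro eq_vecI) auto
  moreover have "r + s + (1 / 2) \<cdot>\<^sub>v \<phi> a b + - r + (1 / 2) \<cdot>\<^sub>v \<phi> (a + b) (- a) + - s + (1 / 2) \<cdot>\<^sub>v \<phi> b (- b) = \<phi> a b"
    using c form_swap[of a b]
    by (intro eq_vecI)
      (simp_all add: form_add_left form_uminus_right form_self half_add_half two_neq_zero del: times_divide_eq_left)
  ultimately show ?thesis using c by (simp add: eq inv_P mult_P)
qed

lemma commute_P_iff:
  assumes "x \<in> carrier P" "y \<in> carrier P"
  shows "x \<otimes>\<^bsub>P\<^esub> y = y \<otimes>\<^bsub>P\<^esub> x \<longleftrightarrow> \<phi> (fst x) (fst y) = 0\<^sub>v m"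
  using P.commutator_eq_one_iff[OF assms] unfolding commutator_P[OF assms] one_P by simp

text \<open>Multiples of one vector pair to zero under \<open>\<phi>\<close>, so powers are computed
  componentwise. This gives the exponent of the group.\<close>

lemma pow_P:
  assumes "v \<in> carrier_vec n" "u \<in> carrier_vec m"
  shows "(v, u) [^]\<^bsub>P\<^esub> (k::nat) = (of_nat k \<cdot>\<^sub>v v, of_nat k \<cdot>\<^sub>v u)"
proof (induction k)
  case 0
  then show ?case using assms by (auto simp: one_P)
next
  case (Suc k)
  then show ?case
    using assms by (auto simp: mult_P form_smult_left form_self algebra_simps)
qed

section \<open>Subgroups, their projections and their commutators\<close>

lemma kernel_central: "{0\<^sub>v n} \<times> carrier_vec m \<subseteq> group_center P"
  using commute_P_iff by (auto simp: group_center_def carrier_P)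

text \<open>Closure under products uses that half of a value in the subspace \<open>Y\<close> is
  again in \<open>Y\<close>. All subgroups written down explicitly below have this product
  shape.\<close>

lemma subgroup_times:
  assumes "vec_subspace n U" "vec_subspace m Y"
    and "\<And>a b. a \<in> U \<Longrightarrow> b \<in> U \<Longrightarrow> \<phi> a b \<in> Y"
  shows "subgroup (U \<times> Y) P"
proof (rule P.subgroupI)
  note c = vec_subspace_carrier[OF assms(1)] vec_subspace_carrier[OF assms(2)]
  show "U \<times> Y \<subseteq> carrier P" using c by (auto simp: carrier_P)
  show "U \<times> Y \<noteq> {}" using assms(1,2)[THEN vec_subspace_zero] by blast
  fix x assume x: "x \<in> U \<times> Y"
  obtain v u where eq: "x = (v, u)" "v \<in> U" "u \<in> Y" using x by auto
  have "- v = (- 1) \<cdot>\<^sub>v v" "- u = (- 1) \<cdot>\<^sub>v u" by auto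
  then have "- v \<in> U" "- u \<in> Y"
    using vec_subspace_smult[OF assms(1) eq(2), of "- 1"] vec_subspace_smult[OF assms(2) eq(3), of "- 1"] by auto
  then show "inv\<^bsub>P\<^esub> x \<in> U \<times> Y" using eq c by (simp add: inv_P)
  fix y assume "y \<in> U \<times> Y"
  then obtain w z where eq': "y = (w, z)" "w \<in> U" "z \<in> Y" by auto
  have "v + w \<in> U" using vec_subspace_add[OF assms(1)] eq eq' by blast
  moreover have "u + z \<in> Y" using vec_subspace_add[OF assms(2)] eq eq' by blast
  moreover have "u + z + (1 / 2) \<cdot>\<^sub>v \<phi> v w \<in> Y"
    by (rule vec_subspace_add_smult[OF assms(2) \<open>u + z \<in> Y\<close> assms(3)[OF eq(2) eq'(2)]])
  ultimately show "x \<otimes>\<^bsub>P\<^esub> y \<in> U \<times> Y" by (simp only: eq(1) eq'(1) mult_P mem_Times_iff fst_conv snd_conv)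
qed

lemma vec_subspace_carrier_vec: "vec_subspace k (carrier_vec k)"
  by (auto simp: vec_subspace_def)

lemma vec_subspace_fst:
  assumes S: "subgroup S P"
  shows "vec_subspace n (fst ` S)"
proof (rule vec_subspace_mod_ringI)
  show "fst ` S \<subseteq> carrier_vec n" using subgroup.subset[OF S] by (auto simp: carrier_P)
  show "0\<^sub>v n \<in> fst ` S" using subgroup.one_closed[OF S] by (force simp: one_P)
  fix u v assume "u \<in> fst ` S" "v \<in> fst ` S"
  then obtain x y where "x \<in> S" "y \<in> S" "u = fst x" "v = fst y" by blast
  then have "x \<otimes>\<^bsub>P\<^esub> y \<in> S" "fst (x \<otimes>\<^bsub>P\<^esub> y) = u + v"
    using subgroup.m_closed[OF S] by (auto simp: fst_mult_P)
  then show "u + v \<in> fst ` S" by force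
qed

text \<open>On elements with first component zero \<open>\<phi>\<close> contributes nothing, so
  multiplication is addition of second components.\<close>

lemma vec_subspace_snd:
  assumes S: "subgroup S P"
  shows "vec_subspace m {y. (0\<^sub>v n, y) \<in> S}"
proof (rule vec_subspace_mod_ringI)
  show sub: "{y. (0\<^sub>v n, y) \<in> S} \<subseteq> carrier_vec m" using subgroup.subset[OF S] by (auto simp: carrier_P)
  show "0\<^sub>v m \<in> {y. (0\<^sub>v n, y) \<in> S}" using subgroup.one_closed[OF S] by (simp add: one_P)
  fix u v assume "u \<in> {y. (0\<^sub>v n, y) \<in> S}" "v \<in> {y. (0\<^sub>v n, y) \<in> S}"
  then have uv: "(0\<^sub>v n, u) \<in> S" "(0\<^sub>v n, v) \<in> S" by auto
  then have c: "u \<in> carrier_vec m" "v \<in> carrier_vec m" using sub by auto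
  have "(0\<^sub>v n, u) \<otimes>\<^bsub>P\<^esub> (0\<^sub>v n, v) \<in> S" using subgroup.m_closed[OF S uv] .
  moreover have "u + v + (1 / 2) \<cdot>\<^sub>v 0\<^sub>v m = u + v" using c by (intro eq_vecI) auto
  ultimately show "u + v \<in> {y. (0\<^sub>v n, y) \<in> S}" unfolding mult_P by simp
qed

lemma derived_set_P:
  assumes "H \<subseteq> carrier P"
  shows "derived_set P H = {(0\<^sub>v n, \<phi> a b) | a b. a \<in> fst ` H \<and> b \<in> fst ` H}"
proof -
  have "x \<otimes>\<^bsub>P\<^esub> y \<otimes>\<^bsub>P\<^esub> inv\<^bsub>P\<^esub> x \<otimes>\<^bsub>P\<^esub> inv\<^bsub>P\<^esub> y = (0\<^sub>v n, \<phi> (fst x) (fst y))" if "x \<in> H" "y \<in> H" for x y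
    using commutator_P assms that by blast
  then show ?thesis by (auto 4 3)
qed

text \<open>Commutators depend on first components only, so a subgroup may be exchanged for a larger
  or smaller one with the same projection.\<close>

lemma derived_cong:
  assumes "H \<subseteq> carrier P" "K \<subseteq> carrier P" "fst ` H = fst ` K"
  shows "derived P H = derived P K"
  unfolding derived_def derived_set_P[OF assms(1)] derived_set_P[OF assms(2)] assms(3) ..

lemma form_mem_derived:
  assumes "H \<subseteq> carrier P" "a \<in> fst ` H" "b \<in> fst ` H"
  shows "(0\<^sub>v n, \<phi> a b) \<in> derived P H"
  unfolding derived_def derived_set_P[OF assms(1)]
  by (rule generate.incl) (use assms in blast)

lemma derived_subset_kernel:
  assumes "H \<subseteq> carrier P"
  shows "derived P H \<subseteq> {0\<^sub>v n} \<times> carrier_vec m"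
  unfolding derived_def
proof (rule P.generate_subgroup_incl)
  show "derived_set P H \<subseteq> {0\<^sub>v n} \<times> carrier_vec m"
    unfolding derived_set_P[OF assms] by auto
  have "vec_subspace n {0\<^sub>v n :: 'p mod_ring vec}" by (auto simp: vec_subspace_def)
  then show "subgroup ({0\<^sub>v n} \<times> carrier_vec m) P"
    by (rule subgroup_times[OF _ vec_subspace_carrier_vec]) simp
qed

text \<open>A Frattini argument: commutators only depend on first components, so \<open>J\<close> contains \<open>[S, S]\<close>.\<close>

lemma regular_subgroup_eqI:
  assumes S: "subgroup S P" and J: "subgroup J P" "J \<subseteq> S"
    and reg: "derived P S = S \<inter> ({0\<^sub>v n} \<times> carrier_vec m)" and eq: "fst ` J = fst ` S"
  shows "J = S"
proof
  note c = subgroup.subset[OF S] subgroup.subset[OF J(1)]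
  have "derived P S \<subseteq> J"
    using P.derived_incl[OF _ J(1)] derived_cong[OF c(2,1) eq] by auto
  show "S \<subseteq> J"
  proof
    fix x assume x: "x \<in> S"
    then obtain j where j: "j \<in> J" "fst j = fst x" using eq by (metis imageE imageI)
    have jc: "j \<in> carrier P" "x \<in> carrier P" "j \<in> S" using j x c J by auto
    \<comment> \<open>\<open>j\<close> and \<open>x\<close> differ by an element of \<open>S\<close>
      with first component zero; \<open>reg\<close> places it in \<open>[S, S]\<close>, hence in
      \<open>J\<close>.\<close>
    have "inv\<^bsub>P\<^esub> j \<otimes>\<^bsub>P\<^esub> x \<in> S"
      using subgroup.m_closed[OF S] subgroup.m_inv_closed[OF S] x jc by blast
    moreover have "fst (inv\<^bsub>P\<^esub> j \<otimes>\<^bsub>P\<^esub> x) = 0\<^sub>v n"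
      using jc j(2) by (cases j; cases x) (auto simp: fst_mult_P inv_P carrier_P)
    ultimately have "inv\<^bsub>P\<^esub> j \<otimes>\<^bsub>P\<^esub> x \<in> derived P S"
      unfolding reg using c(1) by (auto simp: carrier_P mem_Times_iff subset_eq)
    then have "inv\<^bsub>P\<^esub> j \<otimes>\<^bsub>P\<^esub> x \<in> J" using \<open>derived P S \<subseteq> J\<close> by blast
    then have "j \<otimes>\<^bsub>P\<^esub> (inv\<^bsub>P\<^esub> j \<otimes>\<^bsub>P\<^esub> x) \<in> J" using subgroup.m_closed[OF J(1)] j by blast
    then show "x \<in> J" using jc by (simp add: P.m_assoc[symmetric])
  qed
qed (use J in blast)

text \<open>Under \<open>reg\<close>, two elements of \<open>S\<close> lie in the same coset of
  \<open>[S, S]\<close> exactly when their first components agree.\<close>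

lemma order_factor_derived:
  assumes S: "subgroup S P" and reg: "derived P S = S \<inter> ({0\<^sub>v n} \<times> carrier_vec m)"
  shows "Coset.order (P\<lparr>carrier := S\<rparr> Mod derived P S) = card (fst ` S)"
proof -
  let ?D = "derived P S"
  note c = subgroup.subset[OF S]
  have D: "subgroup ?D P" by (rule P.derived_is_subgroup[OF c])
  have "carrier (P\<lparr>carrier := S\<rparr> Mod ?D) = (\<lambda>x. ?D #>\<^bsub>P\<^esub> x) ` S"
    by (simp add: carrier_FactGroup r_coset_def)
  moreover have "?D #>\<^bsub>P\<^esub> x = ?D #>\<^bsub>P\<^esub> y \<longleftrightarrow> fst x = fst y" if xy: "x \<in> S" "y \<in> S" for x y
  proof -
    have xc: "x \<in> carrier P" "y \<in> carrier P" using xy c by auto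
    have "x \<otimes>\<^bsub>P\<^esub> inv\<^bsub>P\<^esub> y \<in> S"
      using subgroup.m_closed[OF S] subgroup.m_inv_closed[OF S] xy by blast
    then have "x \<otimes>\<^bsub>P\<^esub> inv\<^bsub>P\<^esub> y \<in> ?D \<longleftrightarrow> fst (x \<otimes>\<^bsub>P\<^esub> inv\<^bsub>P\<^esub> y) = 0\<^sub>v n"
      unfolding reg using c by (auto simp: carrier_P mem_Times_iff subset_eq)
    also have "fst (x \<otimes>\<^bsub>P\<^esub> inv\<^bsub>P\<^esub> y) = fst x + - fst y"
      using xc by (cases x; cases y) (auto simp: fst_mult_P inv_P carrier_P)
    also have "fst x + - fst y = 0\<^sub>v n \<longleftrightarrow> fst x = fst y"
    proof
      assume eq: "fst x + - fst y = 0\<^sub>v n"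
      have d: "fst x \<in> carrier_vec n" "fst y \<in> carrier_vec n" using xc by (auto simp: carrier_P)
      show "fst x = fst y"
      proof (rule eq_vecI)
        fix k assume "k < dim_vec (fst y)"
        moreover have "(fst x + - fst y) $ k = 0\<^sub>v n $ k" by (simp only: eq)
        ultimately show "fst x $ k = fst y $ k" using d by simp
      qed (use d in simp)
    qed (use xc in \<open>auto simp: carrier_P\<close>)
    finally show ?thesis using P.r_coset_eq_iff[OF D xc] by simp
  qed
  then have "card ((\<lambda>x. ?D #>\<^bsub>P\<^esub> x) ` S) = card (fst ` S)"
    by (rule card_image_eq_of_same_fibres)
  ultimately show ?thesis by (simp add: Coset.order_def)
qed

end

section \<open>The Baer-Lovasz-Tutte group of a graph\<close>

lemma scalar_prod_elementary_alternating:
  fixes u v :: "'a::field vec"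
  assumes u: "u \<in> carrier_vec n" and v: "v \<in> carrier_vec n" and ij: "1 \<le> i" "i < j" "j \<le> n"
  shows "u \<bullet> (elementary_alternating n i j *\<^sub>v v) = u $ (i - 1) * v $ (j - 1) - u $ (j - 1) * v $ (i - 1)"
proof -
  \<comment> \<open>Only two entries of the product can be nonzero. Pairing it with \<open>u\<close>
    gives the minor used in \<open>edge_form\<close>.\<close>
  have "elementary_alternating n i j *\<^sub>v v
      = v $ (j - 1) \<cdot>\<^sub>v unit_vec n (i - 1) + (- (v $ (i - 1))) \<cdot>\<^sub>v unit_vec n (j - 1)" (is "?A *\<^sub>v v = ?w")
  proof (rule eq_vecI)
    fix r assume "r < dim_vec ?w"
    then have r: "r < n" by simp
    have row: "row ?A r = (if r = i - 1 then unit_vec n (j - 1) else if r = j - 1 then - unit_vec n (i - 1) else 0\<^sub>v n)"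
      using r ij by (intro eq_vecI) (auto simp: elementary_alternating_def unit_vec_def)
    have "(?A *\<^sub>v v) $ r = row ?A r \<bullet> v" using r by (simp add: elementary_alternating_def)
    also have "\<dots> = ?w $ r"
      unfolding row using r v ij by auto
    finally show "(?A *\<^sub>v v) $ r = ?w $ r" .
  qed (simp add: elementary_alternating_def)
  moreover have "i - 1 < n" "j - 1 < n" using ij by auto
  ultimately show ?thesis using u by (simp add: scalar_prod_add_distrib[of _ n] mult.commute)
qed

lemma simple_graph_edgeE:
  assumes "simple_graph {1..n} E" "e \<in> E"
  obtains i j where "e = {i, j}" "1 \<le> i" "i < j" "j \<le> n" "Min e = i" "Max e = j"
proof -
  have "card e = 2" "e \<subseteq> {1..n}" using assms unfolding simple_graph_def by auto
  then obtain i j where e: "e = {i, j}" "i \<noteq> j" by (auto simp: card_2_iff)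
  then have "1 \<le> i" "i \<le> n" "1 \<le> j" "j \<le> n" using \<open>e \<subseteq> {1..n}\<close> by auto
  then show thesis using e that[of i j] that[of j i] by (cases i j rule: linorder_cases) auto
qed

text \<open>\<open>d e\<close> is the coefficient vector of the elementary matrix of the edge \<open>e\<close> in the basis \<open>As\<close>, read
  off on bilinear forms.\<close>

locale baer_lovasz_tutte = alternating_matrices n As
  for n :: nat and As :: "'p::prime_card mod_ring mat list" +
  fixes E :: "nat set set" and d :: "nat set \<Rightarrow> nat \<Rightarrow> 'p mod_ring"
  assumes graph: "simple_graph {1..n} E"
    and edge_form_expand: "e \<in> E \<Longrightarrow> u \<in> carrier_vec n \<Longrightarrow> v \<in> carrier_vec n \<Longrightarrow>
      edge_form u v e = (\<Sum>k<length As. d e k * alternating_form As u v $ k)"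
    and length_le: "length As \<le> card E"

text \<open>The required properties define submodules of matrices, so each is checked on one
  spanning set of \<open>W\<close> and transferred to the other: being alternating passes from the
  generators to \<open>As\<close>, being expandable in the forms of \<open>As\<close> passes from
  \<open>As\<close> to the generators. The length bound is
  \<open>dim W \<le> card E\<close>.\<close>

lemma baer_lovasz_tutte_exists:
  fixes As :: "'p::prime_card mod_ring mat list"
  assumes graph: "simple_graph {1..n} E" and odd: "odd CARD('p)"
    and basis: "ordered_basis_of n (graph_alternating_space n E) As"
  shows "\<exists>d. baer_lovasz_tutte n As E d"
proof -
  let ?K = "class_ring :: 'p mod_ring ring" and ?V = "module_mat TYPE('p mod_ring) n n"
  define gens where "gens = {elementary_alternating n i j :: 'p mod_ring mat | i j. i < j \<and> {i, j} \<in> E}"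
  define W :: "'p mod_ring mat set" where "W = graph_alternating_space n E"
  have finE: "finite E" by (rule simple_graph_finite_edges[OF graph])
  interpret V: vectorspace ?K ?V by (rule matrix_vs)
  have V: "carrier ?V = carrier_mat n n" "\<zero>\<^bsub>?V\<^esub> = 0\<^sub>m n n"
    "\<And>A B. A \<oplus>\<^bsub>?V\<^esub> B = A + B" "\<And>c A. c \<odot>\<^bsub>?V\<^esub> A = c \<cdot>\<^sub>m A"
    by (simp_all add: module_mat_simps)
  have gens: "gens = (\<lambda>e. elementary_alternating n (Min e) (Max e)) ` E"
  proof (intro equalityI subsetI)
    fix A assume "A \<in> gens"
    then obtain i j where A: "A = elementary_alternating n i j" "i < j" "{i, j} \<in> E" by (auto simp: gens_def)
    then have mm: "Min {i, j} = i" "Max {i, j} = j" by auto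
    show "A \<in> (\<lambda>e. elementary_alternating n (Min e) (Max e)) ` E"
      by (rule image_eqI[OF _ A(3)]) (simp only: mm A(1))
  next
    fix A assume "A \<in> (\<lambda>e. elementary_alternating n (Min e) (Max e) :: 'p mod_ring mat) ` E"
    then obtain e where e: "e \<in> E" "A = elementary_alternating n (Min e) (Max e)" by blast
    obtain i j where ij: "e = {i, j}" "1 \<le> i" "i < j" "j \<le> n" "Min e = i" "Max e = j"
      by (rule simple_graph_edgeE[OF graph e(1)])
    have "A = elementary_alternating n i j" unfolding e(2) ij(5,6) ..
    moreover have "{i, j} \<in> E" using e(1) unfolding ij(1) .
    ultimately show "A \<in> gens" using ij(3) unfolding gens_def by blast
  qed
  have gens_carrier: "gens \<subseteq> carrier ?V" unfolding V gens by (auto simp: elementary_alternating_def)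
  have W: "W = V.span gens" by (simp add: W_def gens_def graph_alternating_space_def)
  have W_sub: "submodule ?K W ?V" unfolding W by (rule V.span_is_submodule[OF gens_carrier])
  have W_subspace: "subspace ?K W ?V" unfolding W by (rule V.span_is_subspace[OF gens_carrier])
  interpret W: vectorspace ?K "?V\<lparr>carrier := W\<rparr>" by (rule V.subspace_is_vs[OF W_subspace])
  have gensW: "gens \<subseteq> W" unfolding W by (rule V.in_own_span[OF gens_carrier])
  have b: "distinct As" "W.basis (set As)" using basis unfolding ordered_basis_of_def W_def by auto
  have AsW: "set As \<subseteq> W" using b(2) unfolding W.basis_def by simp
  \<comment> \<open>A span formed inside \<open>W\<close> agrees with the span in the space of all
    matrices, which makes the basis available as a spanning set there.\<close>
  have W_As: "W = V.span (set As)"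
    using b(2) V.span_li_not_depend(1)[OF AsW W_sub] unfolding W.basis_def by simp
  have "W.dim \<le> card gens"
  proof (rule W.gen_ge_dim)
    show "finite gens" unfolding gens using finE by simp
    show "gens \<subseteq> carrier (?V\<lparr>carrier := W\<rparr>)" using gensW by simp
    show "W.span gens = carrier (?V\<lparr>carrier := W\<rparr>)"
      using V.span_li_not_depend(1)[OF gensW W_sub] W by simp
  qed
  also have "\<dots> \<le> card E" unfolding gens using finE by (rule card_image_le)
  finally have len: "length As \<le> card E"
    using W.dim_basis[OF _ b(2)] distinct_card[OF b(1)] by simp

  have form_add: "u \<bullet> ((A + B) *\<^sub>v v) = u \<bullet> (A *\<^sub>v v) + u \<bullet> (B *\<^sub>v v)"
    if "u \<in> carrier_vec n" "v \<in> carrier_vec n" "A \<in> carrier_mat n n" "B \<in> carrier_mat n n"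
    for A B :: "'p mod_ring mat" and u v
    using that by (simp add: add_mult_distrib_mat_vec scalar_prod_add_distrib[of _ n])
  have form_smult: "u \<bullet> ((c \<cdot>\<^sub>m A) *\<^sub>v v) = c * (u \<bullet> (A *\<^sub>v v))"
    if "u \<in> carrier_vec n" "v \<in> carrier_vec n" "A \<in> carrier_mat n n"
    for A :: "'p mod_ring mat" and u v c
  proof -
    have "(c \<cdot>\<^sub>m A) *\<^sub>v v = c \<cdot>\<^sub>v (A *\<^sub>v v)" using that by auto
    then show ?thesis using that by simp
  qed
  have form_zero: "u \<bullet> (0\<^sub>m n n *\<^sub>v v) = (0 :: 'p mod_ring)"
    if "u \<in> carrier_vec n" "v \<in> carrier_vec n" for u v
  proof -
    have "0\<^sub>m n n *\<^sub>v v = 0\<^sub>v n" using that by auto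
    then show ?thesis using that by simp
  qed

  define alt where "alt = {A \<in> carrier_mat n n. \<forall>v\<in>carrier_vec n. v \<bullet> (A *\<^sub>v v) = (0 :: 'p mod_ring)}"
  have "submodule ?K alt ?V"
    unfolding submodule_def V
  proof (intro conjI allI impI)
    show "Module.module ?K ?V" by (rule V.module_axioms)
  qed (auto simp: alt_def form_add form_smult form_zero)
  moreover have "gens \<subseteq> alt"
  proof
    fix A assume "A \<in> gens"
    then obtain e where e: "e \<in> E" "A = elementary_alternating n (Min e) (Max e)" unfolding gens by blast
    obtain i j where "e = {i, j}" "1 \<le> i" "i < j" "j \<le> n" "Min e = i" "Max e = j"
      by (rule simple_graph_edgeE[OF graph e(1)])
    then show "A \<in> alt"
      unfolding alt_def e(2) by (simp add: scalar_prod_elementary_alternating) (simp add: elementary_alternating_def)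
  qed
  ultimately have "W \<subseteq> alt" unfolding W by (intro V.span_is_subset)
  then have As_alt: "set As \<subseteq> alt" using AsW by blast

  \<comment> \<open>Matrices whose bilinear form is a combination of the forms of \<open>As\<close>,
    with coefficients independent of \<open>u\<close> and \<open>v\<close>.\<close>
  define comb where "comb = {A \<in> carrier_mat n n. \<exists>c. \<forall>u\<in>carrier_vec n. \<forall>v\<in>carrier_vec n.
      u \<bullet> (A *\<^sub>v v) = (\<Sum>k<length As. c k * alternating_form As u v $ k :: 'p mod_ring)}"
  have "submodule ?K comb ?V"
    unfolding submodule_def V
  proof (intro conjI allI impI)
    show "Module.module ?K ?V" by (rule V.module_axioms)
    show "0\<^sub>m n n \<in> comb" unfolding comb_def
      by (auto intro!: exI[of _ "\<lambda>_. 0"] simp: form_zero)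
    show "A + B \<in> comb" if A: "A \<in> comb" and B: "B \<in> comb" for A B
    proof -
      obtain a where a: "\<And>u v. u \<in> carrier_vec n \<Longrightarrow> v \<in> carrier_vec n \<Longrightarrow>
          u \<bullet> (A *\<^sub>v v) = (\<Sum>k<length As. a k * alternating_form As u v $ k)"
        using A unfolding comb_def by blast
      obtain b where b: "\<And>u v. u \<in> carrier_vec n \<Longrightarrow> v \<in> carrier_vec n \<Longrightarrow>
          u \<bullet> (B *\<^sub>v v) = (\<Sum>k<length As. b k * alternating_form As u v $ k)"
        using B unfolding comb_def by blast
      have c: "A \<in> carrier_mat n n" "B \<in> carrier_mat n n" using A B by (auto simp: comb_def)
      have "u \<bullet> ((A + B) *\<^sub>v v) = (\<Sum>k<length As. (a k + b k) * alternating_form As u v $ k)"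
        if uv: "u \<in> carrier_vec n" "v \<in> carrier_vec n" for u v
        unfolding form_add[OF uv c] a[OF uv] b[OF uv] by (simp add: distrib_right sum.distrib)
      then show ?thesis unfolding comb_def using c by (intro CollectI conjI exI[of _ "\<lambda>k. a k + b k"]) auto
    qed
    show "x \<cdot>\<^sub>m A \<in> comb" if A: "A \<in> comb" for x A
    proof -
      obtain a where a: "\<And>u v. u \<in> carrier_vec n \<Longrightarrow> v \<in> carrier_vec n \<Longrightarrow>
          u \<bullet> (A *\<^sub>v v) = (\<Sum>k<length As. a k * alternating_form As u v $ k)"
        using A unfolding comb_def by blast
      have c: "A \<in> carrier_mat n n" using A by (auto simp: comb_def)
      have "u \<bullet> ((x \<cdot>\<^sub>m A) *\<^sub>v v) = (\<Sum>k<length As. (x * a k) * alternating_form As u v $ k)"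
        if uv: "u \<in> carrier_vec n" "v \<in> carrier_vec n" for u v
        unfolding form_smult[OF uv c] a[OF uv] by (simp add: sum_distrib_left mult.assoc)
      then show ?thesis unfolding comb_def using c by (intro CollectI conjI exI[of _ "\<lambda>k. x * a k"]) auto
    qed
  qed (auto simp: comb_def)
  moreover have "set As \<subseteq> comb"
  proof
    fix A assume "A \<in> set As"
    then obtain l where l: "l < length As" "A = As ! l" by (metis in_set_conv_nth)
    have lin: "u \<bullet> (A *\<^sub>v v) = (\<Sum>k<length As. of_bool (k = l) * alternating_form As u v $ k)" for u v
    proof -
      have "(\<Sum>k<length As. of_bool (k = l) * alternating_form As u v $ k)
          = (\<Sum>k<length As. if k = l then alternating_form As u v $ k else 0)"
        by (intro sum.cong) auto
      also have "\<dots> = alternating_form As u v $ l" using l(1) by simp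
      finally show ?thesis using l by (simp add: alternating_form_def)
    qed
    have "A \<in> carrier_mat n n" using As_alt \<open>A \<in> set As\<close> by (auto simp: alt_def)
    then show "A \<in> comb" unfolding comb_def
      by (intro CollectI conjI exI[of _ "\<lambda>k. of_bool (k = l)"] ballI lin)
  qed
  ultimately have "W \<subseteq> comb" unfolding W_As by (intro V.span_is_subset)
  have "\<exists>c. \<forall>u\<in>carrier_vec n. \<forall>v\<in>carrier_vec n.
      edge_form u v e = (\<Sum>k<length As. c k * alternating_form As u v $ k)" if e: "e \<in> E" for e
  proof -
    obtain i j where ij: "e = {i, j}" "1 \<le> i" "i < j" "j \<le> n" "Min e = i" "Max e = j"
      by (rule simple_graph_edgeE[OF graph e])
    have "elementary_alternating n (Min e) (Max e) \<in> gens" unfolding gens by (rule imageI[OF e])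
    then have "elementary_alternating n i j \<in> comb"
      unfolding ij(5,6) using \<open>W \<subseteq> comb\<close> gensW by blast
    then obtain c where c: "\<forall>u\<in>carrier_vec n. \<forall>v\<in>carrier_vec n.
        u \<bullet> (elementary_alternating n i j *\<^sub>v v) = (\<Sum>k<length As. c k * alternating_form As u v $ k)"
      unfolding comb_def by blast
    have "edge_form u v e = (\<Sum>k<length As. c k * alternating_form As u v $ k)"
      if uv: "u \<in> carrier_vec n" "v \<in> carrier_vec n" for u v
      unfolding edge_form_def ij(5,6) scalar_prod_elementary_alternating[OF uv ij(2,3,4), symmetric]
      by (rule c[rule_format, OF uv])
    then show ?thesis by blast
  qed
  then obtain d where d: "\<And>e u v. e \<in> E \<Longrightarrow> u \<in> carrier_vec n \<Longrightarrow> v \<in> carrier_vec n \<Longrightarrow>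
      edge_form u v e = (\<Sum>k<length As. d e k * alternating_form As u v $ k)"
    by metis
  have "baer_lovasz_tutte n As E d"
    by unfold_locales (use As_alt odd graph d len in \<open>auto simp: alt_def\<close>)
  then show ?thesis by blast
qed

section \<open>Edge coordinates on the second component\<close>

context baer_lovasz_tutte
begin

text \<open>The value 0 outside \<open>E\<close> makes the result a total function determined by its
  restriction to \<open>E\<close>, so linearity and injectivity become equations between functions.
  On values of \<open>\<phi>\<close> these coordinates are the edge forms.\<close>

definition edge_coords :: "'p mod_ring vec \<Rightarrow> nat set \<Rightarrow> 'p mod_ring" where
  "edge_coords y e = (if e \<in> E then \<Sum>k<m. d e k * y $ k else 0)"

lemma finite_E: "finite E"
  by (rule simple_graph_finite_edges[OF graph])

lemma edge_coords_add:
  assumes "y \<in> carrier_vec m" "z \<in> carrier_vec m"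
  shows "edge_coords (y + z) = (\<lambda>e. edge_coords y e + edge_coords z e)"
  using assms by (auto simp: edge_coords_def distrib_left sum.distrib)

lemma edge_coords_smult:
  assumes "y \<in> carrier_vec m"
  shows "edge_coords (c \<cdot>\<^sub>v y) = (\<lambda>e. c * edge_coords y e)"
  using assms by (auto simp: edge_coords_def sum_distrib_left mult_ac)

lemma edge_coords_zero: "edge_coords (0\<^sub>v m) = (\<lambda>_. 0)"
  by (auto simp: edge_coords_def)

lemma edge_coords_form:
  assumes "e \<in> E" "u \<in> carrier_vec n" "v \<in> carrier_vec n"
  shows "edge_coords (\<phi> u v) e = edge_form u v e"
  using edge_form_expand[OF assms] assms(1) by (simp add: edge_coords_def)

text \<open>Linearity of the image, in the shape in which the lemmas on unit functions and on edge
  cuts expect it of \<open>N\<close>.\<close>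

lemma edge_coords_image_closed:
  assumes Y: "vec_subspace m Y"
  shows "(\<lambda>_. 0) \<in> edge_coords ` Y"
    and "\<And>f g. f \<in> edge_coords ` Y \<Longrightarrow> g \<in> edge_coords ` Y \<Longrightarrow> (\<lambda>e. f e + g e) \<in> edge_coords ` Y"
    and "\<And>c f. f \<in> edge_coords ` Y \<Longrightarrow> (\<lambda>e. c * f e) \<in> edge_coords ` Y"
proof -
  show "(\<lambda>_. 0) \<in> edge_coords ` Y"
    using imageI[OF vec_subspace_zero[OF Y], of edge_coords] unfolding edge_coords_zero .
next
  fix f g assume "f \<in> edge_coords ` Y" "g \<in> edge_coords ` Y"
  then obtain y z where yz: "f = edge_coords y" "g = edge_coords z" "y \<in> Y" "z \<in> Y" by blast
  show "(\<lambda>e. f e + g e) \<in> edge_coords ` Y"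
    unfolding yz(1,2) edge_coords_add[OF yz(3,4)[THEN vec_subspace_carrier[OF Y]], symmetric]
    by (rule imageI[OF vec_subspace_add[OF Y yz(3,4)]])
next
  fix c f assume "f \<in> edge_coords ` Y"
  then obtain y where y: "f = edge_coords y" "y \<in> Y" by blast
  show "(\<lambda>e. c * f e) \<in> edge_coords ` Y"
    unfolding y(1) edge_coords_smult[OF vec_subspace_carrier[OF Y y(2)], symmetric]
    by (rule imageI[OF vec_subspace_smult[OF Y y(2)]])
qed

lemma finite_subset_carrier_vec: "Y \<subseteq> carrier_vec k \<Longrightarrow> finite (Y :: 'p mod_ring vec set)"
  using finite_carrier_vec finite_subset by blast

lemma card_field: "CARD('p mod_ring) = CARD('p)" by simp

lemma one_less_card: "1 < CARD('p)"
  using prime_card prime_gt_1_nat by blast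

text \<open>For an edge \<open>{i, j}\<close> with \<open>i < j\<close> the coordinates of
  \<open>\<phi> e_i e_j\<close> form the unit function of that edge, so a subspace containing all
  values of \<open>\<phi>\<close> maps onto all functions on \<open>E\<close>.\<close>

lemma card_image_edge_coords_ge:
  assumes Y: "vec_subspace m Y"
    and form: "\<And>u v. u \<in> carrier_vec n \<Longrightarrow> v \<in> carrier_vec n \<Longrightarrow> \<phi> u v \<in> Y"
  shows "CARD('p) ^ card E \<le> card (edge_coords ` Y)"
proof -
  have "CARD('p mod_ring) ^ card E \<le> card (edge_coords ` Y)"
  proof (rule card_ge_of_unit_functions[OF _ finite_E edge_coords_image_closed[OF Y]])
    show "finite (edge_coords ` Y)"
      using Y finite_subset_carrier_vec[of Y m] unfolding vec_subspace_def by blast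
    fix e assume e: "e \<in> E"
    obtain i j where ij: "e = {i, j}" "1 \<le> i" "i < j" "j \<le> n"
      by (rule simple_graph_edgeE[OF graph e])
    define g where "g = edge_coords (\<phi> (unit_vec n (i - 1)) (unit_vec n (j - 1)))"
    have "g e' = of_bool (e' = e)" if e': "e' \<in> E" for e'
    proof -
      obtain r l where rl: "e' = {r, l}" "1 \<le> r" "r < l" "l \<le> n"
        by (rule simple_graph_edgeE[OF graph e'])
      have iu: "unit_vec n (x - 1) $ (y - 1) = (of_bool (x = y) :: 'p mod_ring)"
        if "1 \<le> x" "x \<le> n" "1 \<le> y" "y \<le> n" for x y
        using that by (auto simp: unit_vec_def)
      have "g e' = edge_form (unit_vec n (i - 1)) (unit_vec n (j - 1)) {r, l}"
        unfolding g_def rl(1)[symmetric] by (rule edge_coords_form[OF e']) simp_all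
      also have "\<dots> = of_bool (i = r) * of_bool (j = l) - of_bool (i = l) * of_bool (j = r)"
        unfolding edge_form_eq[OF less_imp_neq[OF rl(3)]] using ij rl by (simp only: iu) simp
      \<comment> \<open>Both edges are written in increasing order, so the second product
        vanishes.\<close>
      also have "\<dots> = of_bool (i = r \<and> j = l)" using ij rl by auto
      also have "(i = r \<and> j = l) = (e' = e)" unfolding ij(1) rl(1) doubleton_eq_iff using ij rl by auto
      finally show ?thesis .
    qed
    moreover have "g \<in> edge_coords ` Y" unfolding g_def by (intro imageI form) simp_all
    ultimately show "\<exists>g\<in>edge_coords ` Y. \<forall>e'\<in>E. g e' = of_bool (e' = e)" by blast
  qed
  then show ?thesis unfolding card_field .
qed

text \<open>The basis has at most \<open>card E\<close> elements, and counting the image of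
  \<open>edge_coords\<close> shows at least as many. Equality then forces injectivity: the square
  matrix \<open>d\<close> is invertible.\<close>

lemma length_eq: "m = card E"
  and inj_edge_coords: "inj_on edge_coords (carrier_vec m)"
proof -
  have fin: "finite (carrier_vec m :: 'p mod_ring vec set)" by (rule finite_carrier_vec)
  have "CARD('p) ^ card E \<le> card (edge_coords ` carrier_vec m)"
    by (rule card_image_edge_coords_ge[OF vec_subspace_carrier_vec]) simp
  moreover have le: "card (edge_coords ` carrier_vec m) \<le> card (carrier_vec m :: 'p mod_ring vec set)"
    by (rule card_image_le[OF fin])
  moreover have c: "card (carrier_vec m :: 'p mod_ring vec set) = CARD('p) ^ m"
    unfolding card_carrier_vec card_field ..
  ultimately have "CARD('p) ^ card E \<le> CARD('p) ^ m" by linarith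
  then have "card E \<le> m" using one_less_card by (simp add: power_increasing_iff)
  then show "m = card E" using length_le by simp
  with \<open>CARD('p) ^ card E \<le> card (edge_coords ` carrier_vec m)\<close> le c
  show "inj_on edge_coords (carrier_vec m)"
    using eq_card_imp_inj_on[OF fin, of edge_coords] by simp
qed

text \<open>By the same count, a subspace containing all values of \<open>\<phi>\<close> already has
  as many elements as the whole space.\<close>

lemma form_span:
  assumes Y: "vec_subspace m Y"
    and form: "\<And>u v. u \<in> carrier_vec n \<Longrightarrow> v \<in> carrier_vec n \<Longrightarrow> \<phi> u v \<in> Y"
  shows "Y = carrier_vec m"
proof -
  have sub: "Y \<subseteq> carrier_vec m" using Y unfolding vec_subspace_def by blast
  have "CARD('p) ^ m \<le> card (edge_coords ` Y)"
    using card_image_edge_coords_ge[OF Y form] length_eq by simp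
  also have "\<dots> \<le> card Y" by (rule card_image_le[OF finite_subset_carrier_vec[OF sub]])
  finally have "card (carrier_vec m :: 'p mod_ring vec set) \<le> card Y"
    unfolding card_carrier_vec card_field .
  then show ?thesis using card_seteq[OF finite_carrier_vec sub] by simp
qed

lemma carrier_vec_nonempty: "(carrier_vec k :: 'p mod_ring vec set) \<noteq> {}"
  using zero_carrier_vec[of k] by (metis empty_iff)

lemma fst_carrier_P: "fst ` carrier P = carrier_vec n"
  unfolding carrier_P fst_image_times by (rule if_not_P[OF carrier_vec_nonempty])

text \<open>The second components of \<open>[P, P]\<close> form a subspace containing all values of
  \<open>\<phi>\<close>, hence everything by \<open>form_span\<close>. So \<open>[P, P]\<close> is
  the kernel of the projection to first components.\<close>

lemma derived_P: "derived P (carrier P) = {0\<^sub>v n} \<times> carrier_vec m"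
proof -
  have D: "subgroup (derived P (carrier P)) P" by (rule P.derived_is_subgroup) simp
  have "{y. (0\<^sub>v n, y) \<in> derived P (carrier P)} = carrier_vec m"
  proof (rule form_span[OF vec_subspace_snd[OF D]])
    fix u v :: "'p mod_ring vec" assume uv: "u \<in> carrier_vec n" "v \<in> carrier_vec n"
    show "\<phi> u v \<in> {y. (0\<^sub>v n, y) \<in> derived P (carrier P)}"
      using form_mem_derived[of "carrier P" u v] uv by (simp add: fst_carrier_P)
  qed
  moreover have "derived P (carrier P) \<subseteq> {0\<^sub>v n} \<times> carrier_vec m"
    by (rule derived_subset_kernel) simp
  ultimately show ?thesis by auto
qed

lemma form_eq_zeroI:
  assumes uv: "u \<in> carrier_vec n" "v \<in> carrier_vec n"
    and zero: "\<And>e. e \<in> E \<Longrightarrow> edge_form u v e = 0"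
  shows "\<phi> u v = 0\<^sub>v m"
proof (rule inj_onD[OF inj_edge_coords])
  show "edge_coords (\<phi> u v) = edge_coords (0\<^sub>v m)"
  proof
    fix e show "edge_coords (\<phi> u v) e = edge_coords (0\<^sub>v m) e"
      using edge_coords_form[of e u v] uv zero by (cases "e \<in> E") (simp_all add: edge_coords_def)
  qed
qed simp_all

text \<open>A nonzero minor forces the edge to join the supports of \<open>u\<close> and
  \<open>v\<close>. This controls \<open>\<phi>\<close> between opposite sides in both cut
  constructions.\<close>

lemma edge_form_coord_subspace:
  assumes e: "e \<in> E" and u: "u \<in> coord_subspace n A" and v: "v \<in> coord_subspace n B"
    and nz: "edge_form u v e \<noteq> (0 :: 'p mod_ring)"
  obtains i j where "e = {i, j}" "i \<in> A" "j \<in> B"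
proof -
  obtain i j where ij: "e = {i, j}" "1 \<le> i" "i < j" "j \<le> n"
    by (rule simple_graph_edgeE[OF graph e])
  then have "u $ (i - 1) * v $ (j - 1) \<noteq> 0 \<or> u $ (j - 1) * v $ (i - 1) \<noteq> 0"
    using nz by (auto simp: edge_form_eq)
  moreover have "x \<in> A" if "u $ (x - 1) \<noteq> 0" "1 \<le> x" "x \<le> n" for x
    using coord_subspaceD(2)[OF u, of x] that by auto
  moreover have "x \<in> B" if "v $ (x - 1) \<noteq> 0" "1 \<le> x" "x \<le> n" for x
    using coord_subspaceD(2)[OF v, of x] that by auto
  ultimately have "(i \<in> A \<and> j \<in> B) \<or> (j \<in> A \<and> i \<in> B)" using ij by auto
  then show thesis using that[of i j] that[of j i] ij(1) by (auto simp: insert_commute)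
qed

section \<open>Membership in the class of groups\<close>

lemma regular_subgroup_P_iff:
  "regular_subgroup S P \<longleftrightarrow> subgroup S P \<and> derived P S = S \<inter> ({0\<^sub>v n} \<times> carrier_vec m)"
  unfolding regular_subgroup_def derived_P ..

lemma P_in_baer_class:
  assumes "m \<ge> 1"
  shows "P \<in> baer_class (CARD('p)) n m"
proof -
  have fin: "finite (carrier P)"
    unfolding carrier_P by (intro finite_cartesian_product finite_carrier_vec)
  have "\<not> comm_group P"
  proof
    assume "comm_group P"
    then interpret C: comm_group P .
    have "derived P (carrier P) = {\<one>\<^bsub>P\<^esub>}" by (rule C.derived_eq_singleton) simp
    then have "card (carrier_vec m :: 'p mod_ring vec set) = 1"
      unfolding derived_P one_P by (metis card_cartesian_product_singleton is_singletonI is_singleton_altdef)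
    then show False using assms one_less_card unfolding card_carrier_vec card_field by simp
  qed
  moreover have "group_exponent P = CARD('p)"
    unfolding group_exponent_def
  proof (rule Least_equality)
    show "0 < CARD('p) \<and> (\<forall>x\<in>carrier P. x [^]\<^bsub>P\<^esub> CARD('p) = \<one>\<^bsub>P\<^esub>)"
    proof (intro conjI ballI)
      fix x assume "x \<in> carrier P"
      then obtain v u where x: "x = (v, u)" "v \<in> carrier_vec n" "u \<in> carrier_vec m" by (auto simp: carrier_P)
      then show "x [^]\<^bsub>P\<^esub> CARD('p) = \<one>\<^bsub>P\<^esub>" by (auto simp: pow_P one_P)
    qed simp
    fix k :: nat assume k: "0 < k \<and> (\<forall>x\<in>carrier P. x [^]\<^bsub>P\<^esub> k = \<one>\<^bsub>P\<^esub>)"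
    \<comment> \<open>\<open>m \<ge> 1\<close> supplies a nonzero second component, on which powers
      act as multiples, so \<open>k\<close> is divisible by the characteristic.\<close>
    define w :: "'p mod_ring vec" where "w = unit_vec m 0"
    have "(0\<^sub>v n, w) \<in> carrier P" by (simp add: carrier_P w_def)
    then have "(0\<^sub>v n, w) [^]\<^bsub>P\<^esub> k = \<one>\<^bsub>P\<^esub>" using k by blast
    then have "of_nat k \<cdot>\<^sub>v w = 0\<^sub>v m" by (simp add: pow_P one_P w_def)
    then have "(of_nat k \<cdot>\<^sub>v w) $ 0 = 0\<^sub>v m $ 0" by (simp only:)
    moreover have "0 < m" using assms by linarith
    ultimately have "(of_nat k :: 'p mod_ring) = 0" by (simp add: w_def)
    then show "CARD('p) \<le> k" using of_nat_0_mod_ring_dvd[where 'a = 'p, of k] k by (simp add: dvd_imp_le)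
  qed
  moreover have "Coset.order (P Mod derived P (carrier P)) = CARD('p) ^ n"
  proof -
    \<comment> \<open>The instance with \<open>S\<close> the whole group; updating the record by its
      own carrier changes nothing.\<close>
    have "Coset.order (P\<lparr>carrier := carrier P\<rparr> Mod derived P (carrier P)) = card (fst ` carrier P)"
      by (rule order_factor_derived[OF P.subgroup_self]) (unfold derived_P, unfold carrier_P, auto)
    then show ?thesis by (simp add: fst_carrier_P card_carrier_vec)
  qed
  moreover have "card (derived P (carrier P)) = CARD('p) ^ m"
    unfolding derived_P by (simp add: card_cartesian_product card_carrier_vec)
  ultimately show ?thesis
    unfolding baer_class_def using P.is_group fin kernel_central derived_P by simp
qed

section \<open>Vertex cuts and regular subgroups\<close>

lemma vertex_cut_of_regular_subgroup:
  assumes S: "regular_subgroup S P"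
    and ord: "Coset.order (P\<lparr>carrier := S\<rparr> Mod derived P S) = CARD('p) ^ (n - s)"
    and dec: "admits_central_decomposition (P\<lparr>carrier := S\<rparr>)"
  shows "\<exists>W\<subseteq>{1..n}. card W \<le> s \<and> \<not> graph_connected ({1..n} - W) {e \<in> E. e \<inter> W = {}}"
proof -
  have sub: "subgroup S P" and reg: "derived P S = S \<inter> ({0\<^sub>v n} \<times> carrier_vec m)"
    using S unfolding regular_subgroup_P_iff by blast+
  obtain J K where J: "subgroup J P" "J \<subset> S" and K: "subgroup K P" "K \<subset> S"
    and comm: "\<forall>j\<in>J. \<forall>k\<in>K. j \<otimes>\<^bsub>P\<^esub> k = k \<otimes>\<^bsub>P\<^esub> j" and gen: "\<forall>x\<in>S. \<exists>j\<in>J. \<exists>k\<in>K. x = j \<otimes>\<^bsub>P\<^esub> k"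
    using dec unfolding P.subgroup_admits_central_decomposition_iff[OF sub] by blast
  note carr = subgroup.subset[OF J(1)] subgroup.subset[OF K(1)]
  show ?thesis
  \<comment> \<open>Both factors are projected to first components. The images add up to that of
    \<open>S\<close> and are orthogonal because the factors commute. They stay proper since a
    subgroup of a regular \<open>S\<close> with full projection is all of \<open>S\<close>.\<close>
  proof (rule vertex_cut_of_orthogonal_subspaces[OF graph vec_subspace_fst[OF J(1)] vec_subspace_fst[OF K(1)],
        where U = "fst ` S"])
    show "fst ` S = {u + v | u v. u \<in> fst ` J \<and> v \<in> fst ` K}"
    proof (intro equalityI subsetI)
      fix w assume "w \<in> fst ` S"
      then obtain x where x: "x \<in> S" "w = fst x" by blast
      then obtain j k where jk: "j \<in> J" "k \<in> K" "x = j \<otimes>\<^bsub>P\<^esub> k" using gen by blast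
      show "w \<in> {u + v | u v. u \<in> fst ` J \<and> v \<in> fst ` K}"
        unfolding x(2) jk(3) fst_mult_P using jk(1,2) by blast
    next
      fix w assume "w \<in> {u + v | u v. u \<in> fst ` J \<and> v \<in> fst ` K}"
      then obtain j k where jk: "j \<in> J" "k \<in> K" "w = fst j + fst k" by blast
      then have "j \<otimes>\<^bsub>P\<^esub> k \<in> S" using J K subgroup.m_closed[OF sub] by blast
      then show "w \<in> fst ` S" unfolding jk(3) fst_mult_P[symmetric] by (rule imageI)
    qed
    show "fst ` J \<noteq> fst ` S" using regular_subgroup_eqI[OF sub J(1) _ reg] J(2) by blast
    show "fst ` K \<noteq> fst ` S" using regular_subgroup_eqI[OF sub K(1) _ reg] K(2) by blast
    show "card (fst ` S) = CARD('p mod_ring) ^ (n - s)"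
      using ord order_factor_derived[OF sub reg] by simp
  next
    fix i j u v assume e: "{i, j} \<in> E" and u: "u \<in> fst ` J" and v: "v \<in> fst ` K"
    obtain x y where xy: "u = fst x" "x \<in> J" "v = fst y" "y \<in> K" using u v by blast
    then have c: "x \<in> carrier P" "y \<in> carrier P" using carr by auto
    then have uc: "u \<in> carrier_vec n" "v \<in> carrier_vec n" using xy by (auto simp: carrier_P)
    have "\<phi> u v = 0\<^sub>v m" using comm xy commute_P_iff[OF c] by blast
    then have "edge_form u v {i, j} = 0"
      using edge_coords_form[OF e uc] by (simp add: edge_coords_zero)
    moreover have "i \<noteq> j" using graph e unfolding simple_graph_def by force
    ultimately show "u $ (i - 1) * v $ (j - 1) = u $ (j - 1) * v $ (i - 1)"
      by (simp add: edge_form_eq split: if_splits)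
  qed
qed

text \<open>\<open>S\<close> is the product of the coordinate subspace of the surviving vertices
  with the second components of its own derived subgroup, the choice that makes it regular. The
  commuting factors restrict the first part to the two sides of the cut.\<close>

lemma regular_subgroup_of_vertex_cut:
  assumes W: "W \<subseteq> {1..n}" and cut: "\<not> graph_connected ({1..n} - W) {e \<in> E. e \<inter> W = {}}"
  shows "\<exists>S. regular_subgroup S P \<and>
      Coset.order (P\<lparr>carrier := S\<rparr> Mod derived P S) = CARD('p) ^ (n - card W) \<and>
      admits_central_decomposition (P\<lparr>carrier := S\<rparr>)"
proof -
  obtain a b X where ab: "a \<in> {1..n} - W" "b \<in> {1..n} - W" "a \<in> X" "b \<notin> X"
    and X: "\<forall>x y. {x, y} \<in> {e \<in> E. e \<inter> W = {}} \<longrightarrow> (x \<in> X \<longleftrightarrow> y \<in> X)"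
    by (rule not_graph_connectedE[OF cut]) blast
  note a = ab(1,3) and b = ab(2,4)
  define C where "C = {1..n} - W"
  define U :: "'p mod_ring vec set" where "U = coord_subspace n C"
  \<comment> \<open>\<open>T\<close> breaks the circularity in the choice of \<open>Y\<close>: it
    has the same first components as the later \<open>S\<close>, hence the same derived
    subgroup.\<close>
  define T where "T = U \<times> (carrier_vec m :: 'p mod_ring vec set)"
  define Y where "Y = {y. (0\<^sub>v n, y) \<in> derived P T}"
  have T: "subgroup T P" unfolding T_def U_def
    by (rule subgroup_times[OF vec_subspace_coord vec_subspace_carrier_vec]) simp
  have Tc: "T \<subseteq> carrier P" by (rule subgroup.subset[OF T])
  have fT: "fst ` T = U" unfolding T_def fst_image_times by (rule if_not_P[OF carrier_vec_nonempty])
  have Y: "vec_subspace m Y" unfolding Y_def by (rule vec_subspace_snd[OF P.derived_is_subgroup[OF Tc]])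
  have form: "\<phi> u v \<in> Y" if "u \<in> U" "v \<in> U" for u v
    unfolding Y_def using form_mem_derived[OF Tc] fT that by blast
  define restr where "restr A = (coord_subspace n (C \<inter> A) :: 'p mod_ring vec set) \<times> Y" for A
  have mono: "coord_subspace n (C \<inter> A) \<subseteq> U" for A
    unfolding U_def coord_subspace_def by blast
  have sub: "subgroup (restr A) P" for A unfolding restr_def
    by (rule subgroup_times[OF vec_subspace_coord Y]) (use form mono in blast)
  define S where "S = restr UNIV"
  have S: "subgroup S P" unfolding S_def by (rule sub)
  have S_eq: "S = U \<times> Y" unfolding S_def restr_def U_def by simp
  have Sc: "S \<subseteq> carrier P" by (rule subgroup.subset[OF S])
  have fS: "fst ` S = U" unfolding S_eq using vec_subspace_zero[OF Y] by force
  have "0\<^sub>v n \<in> U" unfolding U_def by (rule vec_subspace_zero[OF vec_subspace_coord])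
  have "derived P S = derived P T" by (rule derived_cong[OF Sc Tc]) (simp add: fS fT)
  moreover have "derived P T = S \<inter> ({0\<^sub>v n} \<times> carrier_vec m)"
    using derived_subset_kernel[OF Tc] \<open>0\<^sub>v n \<in> U\<close> vec_subspace_carrier[OF Y] unfolding S_eq Y_def by auto
  ultimately have reg: "derived P S = S \<inter> ({0\<^sub>v n} \<times> carrier_vec m)" by simp
  have "card C = n - card W" using W by (simp add: C_def card_Diff_subset finite_subset)
  then have ord: "Coset.order (P\<lparr>carrier := S\<rparr> Mod derived P S) = CARD('p) ^ (n - card W)"
    unfolding order_factor_derived[OF S reg] fS U_def by (simp add: card_coord_subspace C_def)
  have proper: "restr A \<subset> S" if "c \<in> C" "c \<notin> A" for A c
  proof -
    have c: "c \<in> {1..n}" using that C_def by blast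
    have "unit_vec n (c - 1) \<in> U" "unit_vec n (c - 1) \<notin> (coord_subspace n (C \<inter> A) :: 'p mod_ring vec set)"
      using that unfolding U_def unit_vec_coord_subspace_iff[OF c] by auto
    then have "(unit_vec n (c - 1), 0\<^sub>v m) \<in> S - restr A"
      unfolding S_eq restr_def using vec_subspace_zero[OF Y] by blast
    moreover have "restr A \<subseteq> S" unfolding S_eq restr_def using mono by blast
    ultimately show ?thesis by blast
  qed
  have comm: "\<forall>j\<in>restr X. \<forall>k\<in>restr (- X). j \<otimes>\<^bsub>P\<^esub> k = k \<otimes>\<^bsub>P\<^esub> j"
  proof (intro ballI)
    fix j k assume j: "j \<in> restr X" and k: "k \<in> restr (- X)"
    have u: "fst j \<in> coord_subspace n (C \<inter> X)" and v: "fst k \<in> coord_subspace n (C \<inter> - X)"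
      using j k unfolding restr_def by auto
    have c: "j \<in> carrier P" "k \<in> carrier P" using j k subgroup.subset[OF sub] by auto
    have "\<phi> (fst j) (fst k) = 0\<^sub>v m"
    proof (rule form_eq_zeroI)
      fix e assume e: "e \<in> E"
      show "edge_form (fst j) (fst k) e = 0"
      proof (rule ccontr)
        assume "edge_form (fst j) (fst k) e \<noteq> 0"
        then obtain x y where xy: "e = {x, y}" "x \<in> C \<inter> X" "y \<in> C \<inter> - X"
          by (rule edge_form_coord_subspace[OF e u v])
        then have "{x, y} \<in> {e \<in> E. e \<inter> W = {}}" using e by (auto simp: C_def)
        then show False using X xy by blast
      qed
    qed (use c in \<open>auto simp: carrier_P\<close>)
    then show "j \<otimes>\<^bsub>P\<^esub> k = k \<otimes>\<^bsub>P\<^esub> j" unfolding commute_P_iff[OF c] .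
  qed
  have gen: "\<forall>x\<in>S. \<exists>j\<in>restr X. \<exists>k\<in>restr (- X). x = j \<otimes>\<^bsub>P\<^esub> k"
  proof
    fix x assume x: "x \<in> S"
    obtain w y where wy: "x = (w, y)" "w \<in> U" "y \<in> Y" using x unfolding S_eq by blast
    have "C = C \<inter> X \<union> C \<inter> - X" by blast
    then obtain u v where uv: "u \<in> coord_subspace n (C \<inter> X)" "v \<in> coord_subspace n (C \<inter> - X)" "w = u + v"
      using coord_subspace_sum wy(2) unfolding U_def by blast
    \<comment> \<open>The product of \<open>(u, z)\<close> and \<open>(v, 0)\<close> adds half of
      \<open>\<phi> u v\<close>, which \<open>z\<close> subtracts in advance.\<close>
    define z where "z = y + (- (1 / 2)) \<cdot>\<^sub>v \<phi> u v"
    have "z \<in> Y" unfolding z_def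
      using uv mono by (intro vec_subspace_add_smult[OF Y wy(3)] form) blast+
    then have "(u, z) \<in> restr X" "(v, 0\<^sub>v m) \<in> restr (- X)"
      using uv vec_subspace_zero[OF Y] unfolding restr_def by auto
    moreover have "x = (u, z) \<otimes>\<^bsub>P\<^esub> (v, 0\<^sub>v m)"
    proof -
      have "y \<in> carrier_vec m" using vec_subspace_carrier[OF Y wy(3)] .
      then have "y = z + 0\<^sub>v m + (1 / 2) \<cdot>\<^sub>v \<phi> u v" unfolding z_def by (intro eq_vecI) auto
      then show ?thesis unfolding mult_P wy(1) uv(3) by simp
    qed
    ultimately show "\<exists>j\<in>restr X. \<exists>k\<in>restr (- X). x = j \<otimes>\<^bsub>P\<^esub> k" by blast
  qed
  have "restr X \<subset> S" "restr (- X) \<subset> S"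
    using proper[of b X] proper[of a "- X"] a b by (auto simp: C_def)
  then have "admits_central_decomposition (P\<lparr>carrier := S\<rparr>)"
    unfolding P.subgroup_admits_central_decomposition_iff[OF S] using sub comm gen by blast
  then show ?thesis using ord S reg unfolding regular_subgroup_P_iff by blast
qed

section \<open>Edge cuts and central subgroups\<close>

lemma edge_cut_of_central_subgroup:
  assumes N: "subgroup N P" "N \<subseteq> group_center P" and card: "card N = CARD('p) ^ s"
    and dec: "admits_central_decomposition (P Mod N)"
  shows "\<exists>F\<subseteq>E. card F \<le> s \<and> \<not> graph_connected {1..n} (E - F)"
proof -
  interpret N: normal N P by (rule P.central_subgroup_normal[OF N])
  obtain J K where J: "subgroup J P" "J \<noteq> carrier P" and K: "subgroup K P" "K \<noteq> carrier P"
    and comm: "\<forall>j\<in>J. \<forall>k\<in>K. j \<otimes>\<^bsub>P\<^esub> k \<otimes>\<^bsub>P\<^esub> inv\<^bsub>P\<^esub> j \<otimes>\<^bsub>P\<^esub> inv\<^bsub>P\<^esub> k \<in> N"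
    and gen: "\<forall>x\<in>carrier P. \<exists>j\<in>J. \<exists>k\<in>K. x = j \<otimes>\<^bsub>P\<^esub> k"
    using dec unfolding N.factor_admits_central_decomposition_iff by blast
  note carr = subgroup.subset[OF J(1)] subgroup.subset[OF K(1)]
  note fP = fst_carrier_P
  have reg: "derived P (carrier P) = carrier P \<inter> ({0\<^sub>v n} \<times> carrier_vec m)"
    unfolding derived_P unfolding carrier_P by auto
  \<comment> \<open>\<open>N\<close> is only known to be central and may contain elements with
    nonzero first component. Commutators have first component zero, so the fibre \<open>Y\<close>
    captures them, and the bound \<open>card Y \<le> card N\<close> is enough.\<close>
  define Y where "Y = {y. (0\<^sub>v n, y) \<in> N}"
  have Y: "vec_subspace m Y" unfolding Y_def by (rule vec_subspace_snd[OF N(1)])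
  have finY: "finite Y" using Y finite_subset_carrier_vec[of Y m] unfolding vec_subspace_def by blast
  have "\<exists>F\<subseteq>E. CARD('p mod_ring) ^ card F \<le> card (edge_coords ` Y) \<and> \<not> graph_connected {1..n} (E - F)"
  proof (rule edge_cut_of_complementary_subspaces[OF graph vec_subspace_fst[OF J(1)] vec_subspace_fst[OF K(1)]
        _ _ _ _ edge_coords_image_closed[OF Y]])
    show "carrier_vec n = {u + v | u v. u \<in> fst ` J \<and> v \<in> fst ` K}"
    proof (intro equalityI subsetI)
      fix w :: "'p mod_ring vec" assume "w \<in> carrier_vec n"
      then obtain x where x: "x \<in> carrier P" "w = fst x" using fP by blast
      then obtain j k where jk: "j \<in> J" "k \<in> K" "x = j \<otimes>\<^bsub>P\<^esub> k" using gen by blast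
      show "w \<in> {u + v | u v. u \<in> fst ` J \<and> v \<in> fst ` K}"
        unfolding x(2) jk(3) fst_mult_P using jk(1,2) by blast
    next
      fix w assume "w \<in> {u + v | u v. u \<in> fst ` J \<and> v \<in> fst ` K}"
      then obtain u v where uv: "w = u + v" "u \<in> fst ` J" "v \<in> fst ` K" by blast
      show "w \<in> carrier_vec n" unfolding uv(1)
        using vec_subspace_carrier[OF vec_subspace_fst[OF J(1)] uv(2)]
          vec_subspace_carrier[OF vec_subspace_fst[OF K(1)] uv(3)] by simp
    qed
    show "fst ` J \<noteq> carrier_vec n"
      using regular_subgroup_eqI[OF P.subgroup_self J(1) carr(1) reg] J(2) fP by auto
    show "fst ` K \<noteq> carrier_vec n"
      using regular_subgroup_eqI[OF P.subgroup_self K(1) carr(2) reg] K(2) fP by auto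
    show "finite (edge_coords ` Y)" using finY by simp
  next
    fix u v assume "u \<in> fst ` J" "v \<in> fst ` K"
    then obtain x y where xy: "u = fst x" "x \<in> J" "v = fst y" "y \<in> K" by blast
    then have c: "x \<in> carrier P" "y \<in> carrier P" using carr by auto
    then have uc: "u \<in> carrier_vec n" "v \<in> carrier_vec n" using xy by (auto simp: carrier_P)
    have "(0\<^sub>v n, \<phi> u v) \<in> N" using comm[rule_format, OF xy(2,4)] unfolding commutator_P[OF c] xy(1,3) .
    then have "\<phi> u v \<in> Y" unfolding Y_def by blast
    then show "\<exists>g\<in>edge_coords ` Y. \<forall>e\<in>E. g e = edge_form u v e"
      using edge_coords_form uc by blast
  qed
  then obtain F where F: "F \<subseteq> E" "CARD('p) ^ card F \<le> card (edge_coords ` Y)"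
    "\<not> graph_connected {1..n} (E - F)" unfolding card_field by blast
  note F(2)
  also have "card (edge_coords ` Y) \<le> card Y" by (rule card_image_le[OF finY])
  also have "card Y \<le> card N"
  proof (rule card_inj_on_le)
    show "inj_on (\<lambda>y. (0\<^sub>v n :: 'p mod_ring vec, y)) Y" by (rule inj_onI) simp
    show "(\<lambda>y. (0\<^sub>v n, y)) ` Y \<subseteq> N" unfolding Y_def by blast
    show "finite N" using card one_less_card card_ge_0_finite[of N] by simp
  qed
  finally have "CARD('p) ^ card F \<le> CARD('p) ^ s" unfolding card .
  then have "card F \<le> s" using one_less_card by (simp add: power_increasing_iff)
  then show ?thesis using F by blast
qed

text \<open>\<open>N\<close> consists of the elements with first component zero whose edge
  coordinates are supported on \<open>F\<close>. Modulo \<open>N\<close> the two sides of the cut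
  commute, since every edge between them lies in \<open>F\<close>.\<close>

lemma central_subgroup_of_edge_cut:
  assumes F: "F \<subseteq> E" and cut: "\<not> graph_connected {1..n} (E - F)"
  shows "\<exists>N. subgroup N P \<and> N \<subseteq> group_center P \<and> card N = CARD('p) ^ card F \<and>
      admits_central_decomposition (P Mod N)"
proof -
  obtain a b X where ab: "a \<in> {1..n}" "b \<in> {1..n}" "a \<in> X" "b \<notin> X"
    and X: "\<forall>x y. {x, y} \<in> E - F \<longrightarrow> (x \<in> X \<longleftrightarrow> y \<in> X)"
    by (rule not_graph_connectedE[OF cut]) blast
  note a = ab(1,3) and b = ab(2,4)
  define Y where "Y = {y \<in> carrier_vec m. \<forall>e\<in>E - F. edge_coords y e = 0}"
  have Y: "vec_subspace m Y"
    unfolding vec_subspace_def Y_def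
    by (auto simp: edge_coords_zero edge_coords_add edge_coords_smult)
  define N where "N = {0\<^sub>v n :: 'p mod_ring vec} \<times> Y"
  have zsub: "vec_subspace n {0\<^sub>v n :: 'p mod_ring vec}" by (auto simp: vec_subspace_def)
  have N: "subgroup N P" unfolding N_def
    by (rule subgroup_times[OF zsub Y]) (use vec_subspace_zero[OF Y] in simp)
  have Nc: "N \<subseteq> group_center P"
    using kernel_central vec_subspace_carrier[OF Y] unfolding N_def by blast
  interpret N: normal N P by (rule P.central_subgroup_normal[OF N Nc])

  \<comment> \<open>\<open>edge_coords\<close> is injective and \<open>m = card E\<close>, so by
    counting every function on \<open>E\<close> arises as edge coordinates.\<close>
  have ext: "\<exists>y\<in>carrier_vec m. edge_coords y = f" if f: "\<And>e. e \<notin> E \<Longrightarrow> f e = 0" for f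
  proof -
    let ?R = "\<lambda>y. restrict (edge_coords y) E"
    have inj: "inj_on ?R (carrier_vec m)"
    proof (rule inj_onI)
      fix y z assume yz: "y \<in> carrier_vec m" "z \<in> carrier_vec m" "?R y = ?R z"
      have "edge_coords y = edge_coords z"
      proof
        fix e show "edge_coords y e = edge_coords z e"
          using fun_cong[OF yz(3), of e] by (cases "e \<in> E") (simp_all add: edge_coords_def)
      qed
      then show "y = z" using inj_onD[OF inj_edge_coords] yz by blast
    qed
    have fin: "finite (E \<rightarrow>\<^sub>E (UNIV :: 'p mod_ring set))" by (rule finite_PiE[OF finite_E]) simp
    have "?R ` carrier_vec m = (E \<rightarrow>\<^sub>E (UNIV :: 'p mod_ring set))"
    proof (rule card_subset_eq[OF fin])
      show "?R ` carrier_vec m \<subseteq> (E \<rightarrow>\<^sub>E UNIV)" by auto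
      show "card (?R ` carrier_vec m) = card (E \<rightarrow>\<^sub>E (UNIV :: 'p mod_ring set))"
        unfolding card_image[OF inj] card_carrier_vec card_PiE[OF finite_E] using length_eq by simp
    qed
    moreover have "restrict f E \<in> (E \<rightarrow>\<^sub>E (UNIV :: 'p mod_ring set))" by simp
    ultimately obtain y where y: "y \<in> carrier_vec m" "restrict f E = ?R y" by blast
    have "edge_coords y = f"
    proof
      fix e show "edge_coords y e = f e"
        using fun_cong[OF y(2), of e] f[of e] by (cases "e \<in> E") (simp_all add: edge_coords_def)
    qed
    then show ?thesis using y(1) by blast
  qed
  have finF: "finite F" using F finite_E finite_subset by blast
  \<comment> \<open>Restriction to \<open>F\<close> identifies \<open>Y\<close> with the functions
    on \<open>F\<close>: elsewhere the coordinates of \<open>Y\<close> vanish, and a function on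
    \<open>F\<close> extends by zero.\<close>
  have "bij_betw (\<lambda>y. restrict (edge_coords y) F) Y (F \<rightarrow>\<^sub>E (UNIV :: 'p mod_ring set))"
  proof (rule bij_betw_imageI)
    show "inj_on (\<lambda>y. restrict (edge_coords y) F) Y"
    proof (rule inj_onI)
      fix y z assume yz: "y \<in> Y" "z \<in> Y" "restrict (edge_coords y) F = restrict (edge_coords z) F"
      have "edge_coords y = edge_coords z"
      proof
        fix e
        consider "e \<in> F" | "e \<in> E - F" | "e \<notin> E" by blast
        then show "edge_coords y e = edge_coords z e"
        proof cases
          case 1 then show ?thesis using fun_cong[OF yz(3), of e] by simp
        next
          case 2 then show ?thesis using yz(1,2) unfolding Y_def by simp
        qed (simp add: edge_coords_def)
      qed
      then show "y = z" using inj_onD[OF inj_edge_coords] yz unfolding Y_def by blast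
    qed
    show "(\<lambda>y. restrict (edge_coords y) F) ` Y = (F \<rightarrow>\<^sub>E (UNIV :: 'p mod_ring set))"
    proof (intro equalityI subsetI)
      fix f :: "nat set \<Rightarrow> 'p mod_ring" assume f: "f \<in> F \<rightarrow>\<^sub>E UNIV"
      define h where "h = (\<lambda>e. if e \<in> F then f e else 0)"
      have "h e = 0" if "e \<notin> E" for e using that F unfolding h_def by auto
      from ext[of h, OF this] obtain y where y: "y \<in> carrier_vec m" "edge_coords y = h" by blast
      have "y \<in> Y" unfolding Y_def using y by (simp add: h_def)
      moreover have "f = restrict (edge_coords y) F"
      proof
        fix e show "f e = restrict (edge_coords y) F e"
          unfolding y(2) h_def using PiE_arb[OF f, of e] by simp
      qed
      ultimately show "f \<in> (\<lambda>y. restrict (edge_coords y) F) ` Y" by blast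
    qed auto
  qed
  then have "card Y = CARD('p) ^ card F" using finF by (simp add: bij_betw_same_card card_PiE)
  then have cardN: "card N = CARD('p) ^ card F" unfolding N_def by (simp add: card_cartesian_product)

  \<comment> \<open>Taking the whole second component makes each factor contain \<open>N\<close>, as
    the description of decompositions of the quotient demands.\<close>
  define part where "part A = (coord_subspace n A :: 'p mod_ring vec set) \<times> (carrier_vec m :: 'p mod_ring vec set)" for A
  have sub: "subgroup (part A) P" for A unfolding part_def
    by (rule subgroup_times[OF vec_subspace_coord vec_subspace_carrier_vec]) simp
  have NA: "N \<subseteq> part A" for A
    unfolding N_def part_def
    using vec_subspace_zero[OF vec_subspace_coord] vec_subspace_carrier[OF Y] by blast
  have proper: "part A \<noteq> carrier P" if c: "c \<in> {1..n}" "c \<notin> A" for A c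
  proof -
    have "(unit_vec n (c - 1), 0\<^sub>v m) \<notin> part A"
      unfolding part_def using c unit_vec_coord_subspace_iff[OF c(1)] by blast
    moreover have "(unit_vec n (c - 1), 0\<^sub>v m) \<in> carrier P" by (simp add: carrier_P)
    ultimately show ?thesis by blast
  qed
  have comm: "\<forall>j\<in>part X. \<forall>k\<in>part (- X). j \<otimes>\<^bsub>P\<^esub> k \<otimes>\<^bsub>P\<^esub> inv\<^bsub>P\<^esub> j \<otimes>\<^bsub>P\<^esub> inv\<^bsub>P\<^esub> k \<in> N"
  proof (intro ballI)
    fix j k assume j: "j \<in> part X" and k: "k \<in> part (- X)"
    have u: "fst j \<in> coord_subspace n X" and v: "fst k \<in> coord_subspace n (- X)"
      using j k unfolding part_def by auto
    have c: "j \<in> carrier P" "k \<in> carrier P" using j k subgroup.subset[OF sub] by auto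
    have "edge_coords (\<phi> (fst j) (fst k)) e = 0" if e: "e \<in> E - F" for e
    proof (rule ccontr)
      assume "edge_coords (\<phi> (fst j) (fst k)) e \<noteq> 0"
      then have "edge_form (fst j) (fst k) e \<noteq> 0"
        using edge_coords_form[of e "fst j" "fst k"] e c by (auto simp: carrier_P)
      then obtain x y where xy: "e = {x, y}" "x \<in> X" "y \<in> - X"
        using edge_form_coord_subspace[OF _ u v] e by blast
      then show False using X e by blast
    qed
    then have "\<phi> (fst j) (fst k) \<in> Y" unfolding Y_def by simp
    then show "j \<otimes>\<^bsub>P\<^esub> k \<otimes>\<^bsub>P\<^esub> inv\<^bsub>P\<^esub> j \<otimes>\<^bsub>P\<^esub> inv\<^bsub>P\<^esub> k \<in> N"
      unfolding commutator_P[OF c] N_def by blast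
  qed
  have gen: "\<forall>x\<in>carrier P. \<exists>j\<in>part X. \<exists>k\<in>part (- X). x = j \<otimes>\<^bsub>P\<^esub> k"
  proof
    fix x assume "x \<in> carrier P"
    then obtain w y where wy: "x = (w, y)" "w \<in> carrier_vec n" "y \<in> carrier_vec m" unfolding carrier_P by blast
    have "w \<in> coord_subspace n UNIV" using wy(2) unfolding coord_subspace_def by simp
    moreover have "UNIV = X \<union> - X" by blast
    ultimately obtain u v where uv: "u \<in> coord_subspace n X" "v \<in> coord_subspace n (- X)" "w = u + v"
      using coord_subspace_sum by blast
    define z where "z = y + (- (1 / 2)) \<cdot>\<^sub>v \<phi> u v"
    have "(u, z) \<in> part X" "(v, 0\<^sub>v m) \<in> part (- X)"
      using uv wy(3) unfolding part_def z_def by auto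
    moreover have "x = (u, z) \<otimes>\<^bsub>P\<^esub> (v, 0\<^sub>v m)"
    proof -
      have "y = z + 0\<^sub>v m + (1 / 2) \<cdot>\<^sub>v \<phi> u v" unfolding z_def using wy(3) by (intro eq_vecI) auto
      then show ?thesis unfolding mult_P wy(1) uv(3) by simp
    qed
    ultimately show "\<exists>j\<in>part X. \<exists>k\<in>part (- X). x = j \<otimes>\<^bsub>P\<^esub> k" by blast
  qed
  have "admits_central_decomposition (P Mod N)"
    unfolding N.factor_admits_central_decomposition_iff
    by (rule exI[of _ "part X"], rule exI[of _ "part (- X)"], intro conjI sub NA comm gen)
      (use a b proper[of b X] proper[of a "- X"] in auto)
  then show ?thesis using N Nc cardN by blast
qed

section \<open>Equality of the connectivities\<close>

lemma vertex_connectivity_eq: "vertex_connectivity {1..n} E = group_kappa (CARD('p)) n P"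
  unfolding vertex_connectivity_def group_kappa_def
proof (rule antisym)
  show "Inf {enat (card U) | U. U \<subseteq> {1..n} \<and> \<not> graph_connected ({1..n} - U) {e \<in> E. e \<inter> U = {}}}
    \<le> Inf {enat s | s. s \<le> n \<and> (\<exists>S. regular_subgroup S P \<and>
          Coset.order (P\<lparr>carrier := S\<rparr> Mod derived P S) = CARD('p) ^ (n - s) \<and>
          admits_central_decomposition (P\<lparr>carrier := S\<rparr>))}" (is "Inf ?A \<le> Inf ?B")
  \<comment> \<open>A decomposition with parameter \<open>s\<close> yields a cut of at most
    \<open>s\<close> vertices, possibly fewer, so the infima are compared by domination. This also
    covers the case of empty sets, where both are infinite.\<close>
  proof (rule Inf_mono)
    fix x assume "x \<in> ?B"
    then obtain s S where "x = enat s" "regular_subgroup S P"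
      "Coset.order (P\<lparr>carrier := S\<rparr> Mod derived P S) = CARD('p) ^ (n - s)"
      "admits_central_decomposition (P\<lparr>carrier := S\<rparr>)" by blast
    moreover from this obtain W where "W \<subseteq> {1..n}" "card W \<le> s"
      "\<not> graph_connected ({1..n} - W) {e \<in> E. e \<inter> W = {}}"
      using vertex_cut_of_regular_subgroup by blast
    ultimately show "\<exists>a\<in>?A. a \<le> x" by (intro bexI[of _ "enat (card W)"]) auto
  qed
  show "Inf ?B \<le> Inf ?A"
  proof (rule Inf_mono)
    fix x assume "x \<in> ?A"
    then obtain W where W: "x = enat (card W)" "W \<subseteq> {1..n}"
      "\<not> graph_connected ({1..n} - W) {e \<in> E. e \<inter> W = {}}" by blast
    \<comment> \<open>The bound built into \<open>group_kappa\<close>, which keeps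
      \<open>n - s\<close> from being truncated.\<close>
    have "card W \<le> n" using card_mono[OF _ W(2)] by simp
    then have "x \<in> ?B" using W(1) regular_subgroup_of_vertex_cut[OF W(2,3)] by blast
    then show "\<exists>b\<in>?B. b \<le> x" by blast
  qed
qed

lemma edge_connectivity_eq: "edge_connectivity {1..n} E = group_lambda (CARD('p)) P"
  unfolding edge_connectivity_def group_lambda_def
proof (rule antisym)
  show "Inf {enat (card F) | F. F \<subseteq> E \<and> \<not> graph_connected {1..n} (E - F)}
    \<le> Inf {enat s | s. \<exists>N. subgroup N P \<and> N \<subseteq> group_center P \<and> card N = CARD('p) ^ s \<and>
          admits_central_decomposition (P Mod N)}" (is "Inf ?A \<le> Inf ?B")
  proof (rule Inf_mono)
    fix x assume "x \<in> ?B"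
    then obtain s N where "x = enat s" "subgroup N P" "N \<subseteq> group_center P" "card N = CARD('p) ^ s"
      "admits_central_decomposition (P Mod N)" by blast
    moreover from this obtain F where "F \<subseteq> E" "card F \<le> s" "\<not> graph_connected {1..n} (E - F)"
      using edge_cut_of_central_subgroup by blast
    ultimately show "\<exists>a\<in>?A. a \<le> x" by (intro bexI[of _ "enat (card F)"]) auto
  qed
  show "Inf ?B \<le> Inf ?A"
  proof (rule Inf_mono)
    fix x assume "x \<in> ?A"
    then obtain F where F: "x = enat (card F)" "F \<subseteq> E" "\<not> graph_connected {1..n} (E - F)" by blast
    then have "x \<in> ?B" using central_subgroup_of_edge_cut[OF F(2,3)] by blast
    then show "\<exists>b\<in>?B. b \<le> x" by blast
  qed
qed

end

theorem theorem1p3: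
  fixes p n m :: nat and E :: "nat set set"
    and As :: "'p::prime_card mod_ring mat list"
    and P :: "('p mod_ring vec \<times> 'p mod_ring vec) monoid"
  assumes "p = CARD('p)" and "Factorial_Ring.prime p" and "odd p"
    and "simple_graph {1..n} E" and "m = card E" and "m \<ge> 1"
    and "ordered_basis_of n (graph_alternating_space n E) As"
    and "P = baer_group n As"
  shows "P \<in> baer_class p n m \<and>
         vertex_connectivity {1..n} E = group_kappa p n P \<and>
         edge_connectivity {1..n} E = group_lambda p P"
proof -
  obtain d where "baer_lovasz_tutte n As E d"
    using baer_lovasz_tutte_exists assms(1,3,4,7) by blast
  then interpret baer_lovasz_tutte n As E d .
  \<comment> \<open>Membership in the class was obtained with the parameter
    \<open>length As\<close>, which \<open>length_eq\<close> identifies with the number of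
    edges.\<close>
  show ?thesis
    using P_in_baer_class vertex_connectivity_eq edge_connectivity_eq length_eq assms by simp
qed

end
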